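(* Let $g=((z_0,\bar z_0),c_0,k)\in G=H_n\rtimes SU(p,q)$ be such that $k+I_n$ is invertible. Then, for each $z\in\mathbb{C}^n$, $$W(\pi(g))(z)=2^n e^{i\lambda c_0}\,|\det(k+I_n)|^{-1}\exp\left(\tfrac{\lambda}{2}\begin{pmatrix}z&\bar z\end{pmatrix}J(\tilde k+I_{2n})^{-1}(\tilde k-I_{2n})\begin{pmatrix}z\\ \bar z\end{pmatrix}\right)$$ $$\times\exp\left(\lambda\begin{pmatrix}z&\bar z\end{pmatrix}J(\tilde k+I_{2n})^{-1}\begin{pmatrix}s(z_0)\\ \overline{s(z_0)}\end{pmatrix}\right)\exp\left(-\tfrac{\lambda}{4}\begin{pmatrix}s(z_0)&\overline{s(z_0)}\end{pmatrix}J(\tilde k+I_{2n})^{-1}\begin{pmatrix}s(z_0)\\ \overline{s(z_0)}\end{pmatrix}\right).$$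
   Context: Let $p,q$ be positive integers, $n=p+q$, and fix $\lambda>0$. For $u,v\in\mathbb{C}^m$ write $uv=\sum_j u_jv_j$ (no conjugation) and $|u|^2=u\bar u$; matrices act on vectors in the usual way. $N^\star$ is the conjugate transpose and $\overline N$ the entrywise conjugate of a matrix $N$. For $u\in\mathbb{C}^n$, $\begin{pmatrix}u&\bar u\end{pmatrix}$ is a row vector of length $2n$ and $\begin{pmatrix}u\\ \bar u\end{pmatrix}$ the corresponding column vector. $SU(p,q)$ is the group of $k\in SL(n,\mathbb{C})$ with $kJ_0k^\star=J_0$, $J_0=\begin{pmatrix}I_p&0\\0&-I_q\end{pmatrix}$; its elements are written as block matrices $\begin{pmatrix}A&B\\C&D\end{pmatrix}$ with blocks of sizes $p\times p$, $p\times q$, $q\times p$, $q\times q$ ($A$, $D$ are invertible). Heisenberg group: $H_n=\{((z,\bar z),c):z\in\mathbb{C}^n,c\in\mathbb{R}\}$ with product $((z,\bar z),c)\cdot((z',\bar z'),c')=((z+z',\bar z+\bar z'),c+c'+\tfrac12\omega((z,\bar z),(z',\bar z')))$, where $\omega((z,w),(z',w'))=\tfrac{i}{2}(z(J_0w')-z'(J_0w))$. $SU(p,q)$ acts on $H_n$ by $k\cdot((z,\bar z),c)=((kz,\overline{kz}),c)$, and $G=H_n\rtimes SU(p,q)$ is the corresponding semidirect product, with elements $((z,\bar z),c,k)$ and product $((z,\bar z),c,k)\cdot((z',\bar z'),c',k')=((z+kz',\overline{z+kz'}),c+c'+\tfrac12\omega((z,\bar z),(kz',\overline{kz'})),kk')$.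 For $z=(z^+,z^-)\in\mathbb{C}^p\times\mathbb{C}^q$ put $s(z)=(z^+,\overline{z^-})$. Fock space: $\mathcal{F}$ is the Hilbert space of holomorphic functions $f$ on $\mathbb{C}^n$ with $\|f\|^2=\left(\tfrac{\lambda}{2\pi}\right)^n\int_{\mathbb{C}^n}|f(z)|^2e^{-\lambda|z|^2/2}\,dm(z)<\infty$, $dm$ being Lebesgue measure. Put $dm_\lambda=\left(\tfrac{\lambda}{2\pi}\right)^n dm$ and $e_z(w)=\exp(\lambda\bar zw/2)$, so that $f(z)=\langle f,e_z\rangle$. The kernel of an operator $T$ on $\mathcal{F}$ is $k_T(z,w)=\langle Te_w,e_z\rangle$, i.e. $(Tf)(z)=\int k_T(z,w)f(w)e^{-\lambda|w|^2/2}dm_\lambda(w)$. Complex Weyl symbol: $W(T)$ is the function on $\mathbb{C}^n$ defined by $$W(T)(z)=2^n\int_{\mathbb{C}^n}k_T(z+w,z-w)\exp\left(\tfrac{\lambda}{2}(-z\bar z-w\bar w+z\bar w-\bar zw)\right)dm_\lambda(w).$$ Representations: $\rho$ is the unitary representation of $H_n$ on $\mathcal{F}$ given, for $h=((z_0,\bar z_0),c_0)$, by $(\rho(h)f)(z)=e^{i\lambda c_0}\exp\lambda\left(\tfrac12\overline{s(z_0)}z-\tfrac14|z_0|^2\right)f(z-s(z_0))$. The harmonic representation $\sigma$ is the unitary representation of $SU(p,q)$ on $\mathcal{F}$ such that for $k=\begin{pmatrix}A&B\\C&D\end{pmatrix}$ the operator $\sigma(k)$ has kernel $$b_k(z,w)=(\det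 A)^{-1}\exp\tfrac{\lambda}{2}\left(-(\overline D^{-1}\overline C\bar w_1)\bar w_2+(\overline D^{-1}z_2)\bar w_2+(A^{-1}z_1)\bar w_1+z_1(\overline B\,\overline D^{-1}z_2)\right),$$ where $z=(z_1,z_2)$, $w=(w_1,w_2)$, $z_1,w_1\in\mathbb{C}^p$, $z_2,w_2\in\mathbb{C}^q$. It satisfies $\rho(k\cdot h)\sigma(k)=\sigma(k)\rho(h)$. The extended harmonic representation $\pi$ of $G$ on $\mathcal{F}$ is $\pi(h,k)=\rho(h)\sigma(k)$. Matrices: $J=\begin{pmatrix}0&I_n\\-I_n&0\end{pmatrix}$ and, for $k=\begin{pmatrix}A&B\\C&D\end{pmatrix}\in SU(p,q)$, $$\tilde k=\begin{pmatrix}A&0&0&B\\0&\overline D&\overline C&0\\0&\overline B&\overline A&0\\C&0&0&D\end{pmatrix}$$ (block rows and columns of sizes $p,q,p,q$). If $k+I_n$ is invertible then so is $\tilde k+I_{2n}$.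
   Formalization: The factor |det(k+I_n)|^{-1} is corrected to det(k+I_n)^{-1} (the determinant is real), i.e. the printed right side is multiplied by the sign of det(k+I_n); as printed it fails for p=2, q=1, k=e^{2πi/3}I_3, z=z_0=0, c_0=0, where W=-8, not 8. *)

theory Defs
  imports "HOL-Analysis.Analysis" "HOL-Algebra.Group"
begin

text \<open>
  The positive integers p, q are the cardinalities of the (finite, nonempty) index types
  \<open>'p\<close>, \<open>'q\<close>; C^n with n = p + q is \<open>complex ^ ('p + 'q)\<close>, and C^2n is
  \<open>complex ^ (('p + 'q) + ('p + 'q))\<close>. The parameter lambda is written \<open>lam\<close>.
\<close>

section \<open>Vectors and matrices\<close>

text \<open>The product uv is bilinear, hence different from the (real) inner product of the library.\<close>

definition dot :: "complex ^ 'n \<Rightarrow> complex ^ 'n \<Rightarrow> complex"  (infixl "\<bullet>\<^sub>C" 70)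
  where "u \<bullet>\<^sub>C v = (\<Sum>j\<in>UNIV. u $ j * v $ j)"

definition cnj_vec :: "complex ^ 'n \<Rightarrow> complex ^ 'n"
  where "cnj_vec u = (\<chi> j. cnj (u $ j))"

definition cnj_mat :: "complex ^ 'n ^ 'm \<Rightarrow> complex ^ 'n ^ 'm"
  where "cnj_mat M = map_matrix cnj M"

definition conj_transpose :: "complex ^ 'n ^ 'm \<Rightarrow> complex ^ 'm ^ 'n"
  where "conj_transpose M = transpose (cnj_mat M)"

definition join_vec :: "'a ^ 'r \<Rightarrow> 'a ^ 's \<Rightarrow> 'a ^ ('r + 's)"
  where "join_vec u v = (\<chi> i. case i of Inl a \<Rightarrow> u $ a | Inr b \<Rightarrow> v $ b)"

definition upper_vec :: "'a ^ ('r::finite + 's::finite) \<Rightarrow> 'a ^ 'r"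
  where "upper_vec u = (\<chi> a. u $ Inl a)"

definition lower_vec :: "'a ^ ('r::finite + 's::finite) \<Rightarrow> 'a ^ 's"
  where "lower_vec u = (\<chi> b. u $ Inr b)"

text \<open>\<open>block_mat A B C D\<close> has the block rows (A B) and (C D).\<close>

definition block_mat ::
    "'a ^ 'c ^ 'r \<Rightarrow> 'a ^ 'd ^ 'r \<Rightarrow> 'a ^ 'c ^ 's \<Rightarrow> 'a ^ 'd ^ 's \<Rightarrow> 'a ^ ('c + 'd) ^ ('r + 's)"
  where "block_mat A B C D =
    (\<chi> i. case i of Inl a \<Rightarrow> join_vec (A $ a) (B $ a) | Inr b \<Rightarrow> join_vec (C $ b) (D $ b))"

definition blockA :: "'a ^ ('c::finite + 'd::finite) ^ ('r::finite + 's::finite) \<Rightarrow> 'a ^ 'c ^ 'r"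
  where "blockA M = (\<chi> i j. M $ Inl i $ Inl j)"

definition blockB :: "'a ^ ('c::finite + 'd::finite) ^ ('r::finite + 's::finite) \<Rightarrow> 'a ^ 'd ^ 'r"
  where "blockB M = (\<chi> i j. M $ Inl i $ Inr j)"

definition blockC :: "'a ^ ('c::finite + 'd::finite) ^ ('r::finite + 's::finite) \<Rightarrow> 'a ^ 'c ^ 's"
  where "blockC M = (\<chi> i j. M $ Inr i $ Inl j)"

definition blockD :: "'a ^ ('c::finite + 'd::finite) ^ ('r::finite + 's::finite) \<Rightarrow> 'a ^ 'd ^ 's"
  where "blockD M = (\<chi> i j. M $ Inr i $ Inr j)"

definition J0 :: "complex ^ ('p::finite + 'q::finite) ^ ('p + 'q)"
  where "J0 = block_mat (mat 1) 0 0 (- mat 1)"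

definition Jmat :: "complex ^ ('n::finite + 'n) ^ ('n + 'n)"
  where "Jmat = block_mat 0 (mat 1) (- mat 1) 0"

text \<open>
  With block rows and columns of sizes p, q, p, q this is the matrix with block rows
  (A, 0, 0, B), (0, cnj D, cnj C, 0), (0, cnj B, cnj A, 0), (C, 0, 0, D).
\<close>

definition tilde_mat ::
    "complex ^ ('p::finite + 'q::finite) ^ ('p + 'q) \<Rightarrow>
     complex ^ (('p + 'q) + ('p + 'q)) ^ (('p + 'q) + ('p + 'q))"
  where "tilde_mat k = block_mat
    (block_mat (blockA k) 0 0 (cnj_mat (blockD k)))
    (block_mat 0 (blockB k) (cnj_mat (blockC k)) 0)
    (block_mat 0 (cnj_mat (blockB k)) (blockC k) 0)
    (block_mat (cnj_mat (blockA k)) 0 0 (blockD k))"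

definition s_map :: "complex ^ ('p::finite + 'q::finite) \<Rightarrow> complex ^ ('p + 'q)"
  where "s_map z = join_vec (upper_vec z) (cnj_vec (lower_vec z))"

section \<open>The groups\<close>

definition SU_pq :: "(complex ^ ('p::finite + 'q::finite) ^ ('p + 'q)) set"
  where "SU_pq = {k. det k = 1 \<and> k ** J0 ** conj_transpose k = J0}"

definition omega ::
    "(complex ^ ('p::finite + 'q::finite)) \<times> (complex ^ ('p + 'q)) \<Rightarrow>
     (complex ^ ('p + 'q)) \<times> (complex ^ ('p + 'q)) \<Rightarrow> complex"
  where "omega = (\<lambda>(z, w) (z', w'). \<i> / 2 * (z \<bullet>\<^sub>C (J0 *v w') - z' \<bullet>\<^sub>C (J0 *v w)))"

text \<open>
  The form \<open>omega\<close> takes real values on pairs (z, cnj z), (z', cnj z'), so \<open>Re\<close> below is only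
  a coercion.
\<close>

definition heisenberg ::
    "(((complex ^ ('p::finite + 'q::finite)) \<times> (complex ^ ('p + 'q))) \<times> real) monoid"
  where "heisenberg =
    \<lparr> carrier = {((z, cnj_vec z), c) | z c. True},
      mult = (\<lambda>(u, c) (u', c'). (u + u', c + c' + Re (omega u u') / 2)),
      one = (0, 0) \<rparr>"

definition SU_act ::
    "complex ^ ('p::finite + 'q::finite) ^ ('p + 'q) \<Rightarrow>
     (complex ^ ('p + 'q)) \<times> (complex ^ ('p + 'q)) \<Rightarrow>
     (complex ^ ('p + 'q)) \<times> (complex ^ ('p + 'q))"
  where "SU_act k = (\<lambda>(z, w). (k *v z, cnj_mat k *v w))"

text \<open>The semidirect product of the Heisenberg group and SU(p,q).\<close>

definition G_group ::
    "(((complex ^ ('p::finite + 'q::finite)) \<times> (complex ^ ('p + 'q))) \<times> real \<times>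
      (complex ^ ('p + 'q) ^ ('p + 'q))) monoid"
  where "G_group =
    \<lparr> carrier = {(u, c, k). (u, c) \<in> carrier heisenberg \<and> k \<in> SU_pq},
      mult = (\<lambda>(u, c, k) (u', c', k').
        case (u, c) \<otimes>\<^bsub>heisenberg\<^esub> (SU_act k u', c') of (u'', c'') \<Rightarrow> (u'', c'', k ** k')),
      one = (0, 0, mat 1) \<rparr>"

section \<open>Fock space and the complex Weyl symbol\<close>

definition dm_lam :: "real \<Rightarrow> (complex ^ 'n) measure"
  where "dm_lam lam = density lborel (\<lambda>_. ennreal ((lam / (2 * pi)) ^ CARD('n)))"

definition holomorphic_Cn :: "(complex ^ 'n \<Rightarrow> complex) \<Rightarrow> bool"
  where "holomorphic_Cn f \<longleftrightarrow>
    (\<forall>z. \<exists>f'. (f has_derivative f') (at z) \<and> (\<forall>c v. f' (c *s v) = c * f' v))"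

text \<open>
  Operators on Fock space are represented by maps on all functions on C^n; only their
  values on \<open>fock_space\<close> matter.
\<close>

definition fock_space :: "real \<Rightarrow> (complex ^ 'n \<Rightarrow> complex) set"
  where "fock_space lam = {f. holomorphic_Cn f \<and>
    integrable (dm_lam lam) (\<lambda>z. (cmod (f z))\<^sup>2 * exp (- lam * (norm z)\<^sup>2 / 2))}"

definition fock_inner ::
    "real \<Rightarrow> (complex ^ 'n \<Rightarrow> complex) \<Rightarrow> (complex ^ 'n \<Rightarrow> complex) \<Rightarrow> complex"
  where "fock_inner lam f g =
    (LINT z|dm_lam lam. f z * cnj (g z) * of_real (exp (- lam * (norm z)\<^sup>2 / 2)))"

definition coherent :: "real \<Rightarrow> complex ^ 'n \<Rightarrow> complex ^ 'n \<Rightarrow> complex"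
  where "coherent lam z w = exp (of_real lam * (cnj_vec z \<bullet>\<^sub>C w) / 2)"

definition op_kernel ::
    "real \<Rightarrow> ((complex ^ 'n \<Rightarrow> complex) \<Rightarrow> (complex ^ 'n \<Rightarrow> complex)) \<Rightarrow>
     complex ^ 'n \<Rightarrow> complex ^ 'n \<Rightarrow> complex"
  where "op_kernel lam T z w = fock_inner lam (T (coherent lam w)) (coherent lam z)"

definition weyl_symbol ::
    "real \<Rightarrow> ((complex ^ 'n \<Rightarrow> complex) \<Rightarrow> (complex ^ 'n \<Rightarrow> complex)) \<Rightarrow>
     complex ^ 'n \<Rightarrow> complex"
  where "weyl_symbol lam T z = 2 ^ CARD('n) *
    (LINT w|dm_lam lam. op_kernel lam T (z + w) (z - w) *
      exp (of_real lam / 2 *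
        (- (z \<bullet>\<^sub>C cnj_vec z) - w \<bullet>\<^sub>C cnj_vec w + z \<bullet>\<^sub>C cnj_vec w - cnj_vec z \<bullet>\<^sub>C w)))"

section \<open>The representations\<close>

definition rho ::
    "real \<Rightarrow> ((complex ^ ('p::finite + 'q::finite)) \<times> (complex ^ ('p + 'q))) \<times> real \<Rightarrow>
     (complex ^ ('p + 'q) \<Rightarrow> complex) \<Rightarrow> (complex ^ ('p + 'q) \<Rightarrow> complex)"
  where "rho lam = (\<lambda>((z0, _), c0) f z.
    exp (\<i> * of_real lam * of_real c0) *
    exp (of_real lam * (cnj_vec (s_map z0) \<bullet>\<^sub>C z / 2 - of_real ((norm z0)\<^sup>2) / 4)) *
    f (z - s_map z0))"

definition sigma_kernel ::
    "real \<Rightarrow> complex ^ ('p::finite + 'q::finite) ^ ('p + 'q) \<Rightarrow>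
     complex ^ ('p + 'q) \<Rightarrow> complex ^ ('p + 'q) \<Rightarrow> complex"
  where "sigma_kernel lam k z w =
   (let A = blockA k; B = blockB k; C = blockC k; D = blockD k;
        z1 = upper_vec z; z2 = lower_vec z;
        w1 = upper_vec w; w2 = lower_vec w;
        Dbar_inv = matrix_inv (cnj_mat D)
    in inverse (det A) *
       exp (of_real lam / 2 *
         (- (((Dbar_inv ** cnj_mat C) *v cnj_vec w1) \<bullet>\<^sub>C cnj_vec w2)
          + (Dbar_inv *v z2) \<bullet>\<^sub>C cnj_vec w2
          + (matrix_inv A *v z1) \<bullet>\<^sub>C cnj_vec w1
          + z1 \<bullet>\<^sub>C ((cnj_mat B ** Dbar_inv) *v z2))))"

text \<open>The harmonic representation of SU(p,q): the operator with the kernel above.\<close>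

definition sigma ::
    "real \<Rightarrow> complex ^ ('p::finite + 'q::finite) ^ ('p + 'q) \<Rightarrow>
     (complex ^ ('p + 'q) \<Rightarrow> complex) \<Rightarrow> (complex ^ ('p + 'q) \<Rightarrow> complex)"
  where "sigma lam k f z =
    (LINT w|dm_lam lam. sigma_kernel lam k z w * f w * of_real (exp (- lam * (norm w)\<^sup>2 / 2)))"

definition pi_rep ::
    "real \<Rightarrow> ((complex ^ ('p::finite + 'q::finite)) \<times> (complex ^ ('p + 'q))) \<times> real \<times>
       (complex ^ ('p + 'q) ^ ('p + 'q)) \<Rightarrow>
     (complex ^ ('p + 'q) \<Rightarrow> complex) \<Rightarrow> (complex ^ ('p + 'q) \<Rightarrow> complex)"
  where "pi_rep lam = (\<lambda>(u, c, k). rho lam (u, c) \<circ> sigma lam k)"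

end

theory Submission
  imports Defs "HOL-Probability.Distributions" "HOL-Real_Asymp.Real_Asymp"
begin

text \<open>
  In the variable \<open>u = s_map w\<close> all exponents that occur are sesquilinear plus linear in \<open>u\<close>, so
  every integral is a Gaussian integral of \<open>exp (- u* M u + a u + b u*)\<close> over C^n with \<open>M\<close> having
  positive definite Hermitian part; its value is a constant times \<open>exp (a M^-1 b) / det M\<close>, without
  any square root. This gives the reproducing property that identifies the kernel of \<open>pi_rep\<close>, and
  then the Weyl symbol. There \<open>M = 1 + V\<close> with \<open>V\<close> unitary, and M = ((A, 0), (C, 1))^-1 (k + 1),
  which yields convergence and \<open>det A * det M = det (k + 1)\<close>. The critical point \<open>u = M^-1 b\<close> is
  the solution of \<open>(k + 1) u = (k - 1) s(z) + z0\<close>, and the critical value is evaluated by the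
  invariance of the indefinite Hermitian form under \<open>k\<close>.
\<close>

section \<open>Gaussian integrals\<close>

text \<open>The kernels contain quadratic terms without conjugation, such as the product of the
  lower part of z with \<open>R\<close> applied to the upper part. For a general Gaussian such terms
  lead to the square root of a determinant of size 2n and to a choice of branch. Here they always
  pair an upper with a lower coordinate, so conjugating the lower coordinates makes them
  sesquilinear. The same map \<open>s_map\<close> turns \<open>tilde_mat k\<close> into
  \<open>k\<close>, so the inverse in dimension 2n reduces to a linear equation on C^n.

  Since \<open>sigma\<close> is an integral operator and \<open>op_kernel\<close> a matrix
  coefficient, the kernel of \<open>pi_rep\<close> is not given but costs two reproducing integrals;
  they are computed only for exponentials of the quadratic polynomials that occur.

  The Gaussian integral yields the inverse of det (k + 1) itself. This number is real but can be
  negative, so its sign accompanies the inverse of its modulus in the final formula.\<close>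

text \<open>The mean value inequality on the convex set bounds the difference quotients by
  \<open>w\<close>, so dominated convergence applies. The derivative is taken within
  \<open>S\<close> because Gaussians have a common majorant only on a half-plane of quadratic
  coefficients or a disc of linear ones.\<close>

lemma DERIV_integral:
  fixes f :: "complex \<Rightarrow> 'a \<Rightarrow> complex"
  assumes "convex S" and t: "t \<in> S"
    and int: "\<And>t. t \<in> S \<Longrightarrow> integrable M (f t)"
    and der: "\<And>t x. t \<in> S \<Longrightarrow> ((\<lambda>t. f t x) has_field_derivative f' t x) (at t within S)"
    and le: "\<And>t x. t \<in> S \<Longrightarrow> norm (f' t x) \<le> w x"
    and w: "integrable M w"
    and meas: "f' t \<in> borel_measurable M"
  shows "((\<lambda>t. LINT x|M. f t x) has_field_derivative (LINT x|M. f' t x)) (at t within S)"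
  unfolding has_field_derivative_iff tendsto_at_iff_sequentially comp_def
proof (intro allI impI)
  fix X assume X: "\<forall>i. X i \<in> S - {t}" and lim: "X \<longlonglongrightarrow> t"
  have "(\<lambda>i. LINT x|M. (f (X i) x - f t x) / (X i - t)) \<longlonglongrightarrow> (LINT x|M. f' t x)"
  proof (rule integral_dominated_convergence[where w=w])
    show "(\<lambda>x. (f (X i) x - f t x) / (X i - t)) \<in> borel_measurable M" for i
      using X int t by (auto intro!: borel_measurable_divide borel_measurable_diff)
    show "AE x in M. (\<lambda>i. (f (X i) x - f t x) / (X i - t)) \<longlonglongrightarrow> f' t x"
      using der[OF t] X lim
      unfolding has_field_derivative_iff tendsto_at_iff_sequentially comp_def by auto
    show "AE x in M. norm ((f (X i) x - f t x) / (X i - t)) \<le> w x" for i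
    proof (rule AE_I2)
      fix x
      have "norm (f (X i) x - f t x) \<le> w x * norm (X i - t)"
        using X by (intro field_differentiable_bound[OF \<open>convex S\<close> der le] t) auto
      moreover have "X i - t \<noteq> 0" using X by auto
      ultimately show "norm ((f (X i) x - f t x) / (X i - t)) \<le> w x"
        by (simp add: norm_divide divide_le_eq)
    qed
  qed (use meas w in auto)
  moreover have "(LINT x|M. (f (X i) x - f t x) / (X i - t)) =
      ((LINT x|M. f (X i) x) - (LINT x|M. f t x)) / (X i - t)" for i
    using X int t by (subst integral_divide_zero) (simp add: Bochner_Integration.integral_diff)
  ultimately show "(\<lambda>i. ((LINT x|M. f (X i) x) - (LINT x|M. f t x)) / (X i - t))
      \<longlonglongrightarrow> (LINT x|M. f' t x)"
    by (simp only:)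
qed

text \<open>The fundamental theorem of calculus on the whole line; it serves as integration by parts
  without boundary terms.\<close>

lemma integral_vector_derivative_eq_0:
  fixes F f :: "real \<Rightarrow> 'a::euclidean_space"
  assumes "\<And>x. (F has_vector_derivative f x) (at x)" "continuous_on UNIV f" "integrable lborel f"
    "(F \<longlongrightarrow> 0) at_top" "(F \<longlongrightarrow> 0) at_bot"
  shows "(LINT x|lborel. f x) = 0"
proof -
  have "(LBINT x=-\<infinity>..\<infinity>. f x) = 0 - 0"
    using assms
    by (intro interval_integral_FTC_integrable)
      (auto simp: continuous_on_eq_continuous_at set_integrable_def
          ereal_tendsto_simps)
  then show ?thesis by (simp add: interval_lebesgue_integral_def set_lebesgue_integral_def)
qed

lemma integrable_exp_neg_square:
  fixes c :: real
  assumes "c > 0"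
  shows "integrable lborel (\<lambda>s::real. exp (- c * s\<^sup>2))"
proof -
  have "integrable lborel (\<lambda>s. sqrt (pi / c) * normal_density 0 (sqrt (1 / (2 * c))) s)"
    by (intro integrable_mult_right integrable_normal_density) (use assms in simp)
  also have "(\<lambda>s. sqrt (pi / c) * normal_density 0 (sqrt (1 / (2 * c))) s) = (\<lambda>s. exp (- c * s\<^sup>2))"
    using assms by (auto simp: normal_density_def field_simps)
  finally show ?thesis .
qed

lemma integral_exp_neg_square: "(LINT s|lborel. exp (- s\<^sup>2)) = sqrt pi"
proof -
  have "(LINT s|lborel. sqrt pi * normal_density 0 (sqrt (1 / 2)) s) = sqrt pi"
    by (subst integral_mult_right_zero, subst integral_normal_density) simp_all
  also have "(\<lambda>s. sqrt pi * normal_density 0 (sqrt (1 / 2)) s) = (\<lambda>s. exp (- s\<^sup>2))"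
    by (auto simp: normal_density_def field_simps)
  finally show ?thesis .
qed

text \<open>Half of the decay pays for the other factors: a quarter of \<mu> absorbs the polynomial,
  another quarter absorbs the linear term after completing a square.\<close>

lemma poly_gauss_bound:
  fixes \<mu> G :: real
  assumes "\<mu> > 0"
  obtains K where "K \<ge> 0" "\<And>s::real. (1 + s\<^sup>2) * exp (- \<mu> * s\<^sup>2 + G * \<bar>s\<bar>) \<le> K * exp (- (\<mu> / 2) * s\<^sup>2)"
proof
  let ?c = "\<mu> / 4"
  show "(1 + 1 / ?c) * exp (G\<^sup>2 / \<mu>) \<ge> 0" using assms by simp
  fix s :: real
  have "1 + s\<^sup>2 \<le> (1 + 1 / ?c) * (1 + ?c * s\<^sup>2)"
    using assms by (simp add: field_simps)
  also have "\<dots> \<le> (1 + 1 / ?c) * exp (?c * s\<^sup>2)"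
    using assms by (intro mult_left_mono exp_ge_add_one_self) auto
  finally have 1: "1 + s\<^sup>2 \<le> (1 + 1 / ?c) * exp (?c * s\<^sup>2)" .
  have "0 \<le> (\<mu> * \<bar>s\<bar> / 2 - G)\<^sup>2 / \<mu>" using assms by simp
  also have "\<dots> = ?c * s\<^sup>2 + G\<^sup>2 / \<mu> - G * \<bar>s\<bar>"
    using assms by (simp add: power2_eq_square field_simps)
  finally have "exp (- \<mu> * s\<^sup>2 + G * \<bar>s\<bar>) \<le> exp (- \<mu> * s\<^sup>2 + ?c * s\<^sup>2 + G\<^sup>2 / \<mu>)" by simp
  then have "(1 + s\<^sup>2) * exp (- \<mu> * s\<^sup>2 + G * \<bar>s\<bar>)
      \<le> ((1 + 1 / ?c) * exp (?c * s\<^sup>2)) * exp (- \<mu> * s\<^sup>2 + ?c * s\<^sup>2 + G\<^sup>2 / \<mu>)"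
    using 1 assms by (intro mult_mono) auto
  also have "\<dots> = ((1 + 1 / ?c) * exp (G\<^sup>2 / \<mu>)) * exp (?c * s\<^sup>2 - \<mu> * s\<^sup>2 + ?c * s\<^sup>2)"
  proof -
    have "exp (?c * s\<^sup>2) * exp (- \<mu> * s\<^sup>2 + ?c * s\<^sup>2 + G\<^sup>2 / \<mu>) =
        exp (G\<^sup>2 / \<mu>) * exp (?c * s\<^sup>2 - \<mu> * s\<^sup>2 + ?c * s\<^sup>2)"
      by (simp flip: exp_add add: algebra_simps)
    then show ?thesis by (simp only: mult.assoc)
  qed
  also have "?c * s\<^sup>2 - \<mu> * s\<^sup>2 + ?c * s\<^sup>2 = - (\<mu> / 2) * s\<^sup>2" by (simp add: field_simps)
  finally show "(1 + s\<^sup>2) * exp (- \<mu> * s\<^sup>2 + G * \<bar>s\<bar>)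
      \<le> (1 + 1 / ?c) * exp (G\<^sup>2 / \<mu>) * exp (- (\<mu> / 2) * s\<^sup>2)" .
qed

definition gauss :: "complex \<Rightarrow> complex \<Rightarrow> real \<Rightarrow> complex"
  where "gauss m \<gamma> s = exp (- m * of_real (s\<^sup>2) + \<gamma> * of_real s)"

lemma continuous_on_gauss [continuous_intros]: "continuous_on S (gauss m \<gamma>)"
  unfolding gauss_def by (intro continuous_intros)

text \<open>One majorant for a whole set of parameters. The polynomial factor is included so that it
  also covers the derivatives in \<open>m\<close> and \<gamma>, which bring down s^2 and s.\<close>

lemma gauss_bound:
  assumes "\<mu> > 0"
  obtains K where "K \<ge> 0"
    "\<And>m \<gamma> s. \<mu> \<le> Re m \<Longrightarrow> norm \<gamma> \<le> G \<Longrightarrow>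
      (1 + s\<^sup>2) * norm (gauss m \<gamma> s) \<le> K * exp (- (\<mu> / 2) * s\<^sup>2)"
proof -
  obtain K where K: "K \<ge> 0"
    "\<And>s::real. (1 + s\<^sup>2) * exp (- \<mu> * s\<^sup>2 + G * \<bar>s\<bar>) \<le> K * exp (- (\<mu> / 2) * s\<^sup>2)"
    using poly_gauss_bound[OF assms] by metis
  have "(1 + s\<^sup>2) * norm (gauss m \<gamma> s) \<le> K * exp (- (\<mu> / 2) * s\<^sup>2)"
    if "\<mu> \<le> Re m" "norm \<gamma> \<le> G" for m \<gamma> s
  proof -
    have "Re \<gamma> * s \<le> \<bar>Re \<gamma>\<bar> * \<bar>s\<bar>" by (metis abs_ge_self abs_mult)
    also have "\<dots> \<le> G * \<bar>s\<bar>"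
      using abs_Re_le_cmod[of \<gamma>] that by (intro mult_right_mono) auto
    finally have "norm (gauss m \<gamma> s) \<le> exp (- \<mu> * s\<^sup>2 + G * \<bar>s\<bar>)"
      using mult_right_mono[OF that(1), of "s\<^sup>2"] by (simp add: gauss_def)
    then have "(1 + s\<^sup>2) * norm (gauss m \<gamma> s) \<le> (1 + s\<^sup>2) * exp (- \<mu> * s\<^sup>2 + G * \<bar>s\<bar>)"
      by (intro mult_left_mono) auto
    with K show ?thesis by (metis order_trans)
  qed
  then show ?thesis by (rule that[OF K(1)])
qed

lemma integrable_mult_gauss:
  fixes p :: "real \<Rightarrow> complex"
  assumes "Re m > 0" "continuous_on UNIV p" and p: "\<And>s. norm (p s) \<le> C * (1 + s\<^sup>2)"
  shows "integrable lborel (\<lambda>s. p s * gauss m \<gamma> s)"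
proof -
  obtain K where K: "K \<ge> 0"
    "\<And>s. (1 + s\<^sup>2) * norm (gauss m \<gamma> s) \<le> K * exp (- (Re m / 2) * s\<^sup>2)"
    using gauss_bound[OF assms(1), of "norm \<gamma>"] by (metis order_refl)
  have C: "C \<ge> 0" using order_trans[OF norm_ge_zero p[of 0]] by simp
  show ?thesis
  proof (rule Bochner_Integration.integrable_bound)
    show "integrable lborel (\<lambda>s. C * K * exp (- (Re m / 2) * s\<^sup>2))"
      using assms(1) by (intro integrable_mult_right integrable_exp_neg_square) simp
    show "(\<lambda>s. p s * gauss m \<gamma> s) \<in> borel_measurable lborel"
      using assms(2) by (simp add: borel_measurable_continuous_onI continuous_on_mult continuous_on_gauss)
    show "AE s in lborel. norm (p s * gauss m \<gamma> s) \<le> norm (C * K * exp (- (Re m / 2) * s\<^sup>2))"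
    proof (rule AE_I2)
      fix s
      have "norm (p s * gauss m \<gamma> s) \<le> C * (1 + s\<^sup>2) * norm (gauss m \<gamma> s)"
        by (simp add: norm_mult mult_right_mono p)
      also have "\<dots> \<le> C * (K * exp (- (Re m / 2) * s\<^sup>2))"
        using mult_left_mono[OF K(2) C] by (simp add: mult.assoc)
      finally show "norm (p s * gauss m \<gamma> s) \<le> norm (C * K * exp (- (Re m / 2) * s\<^sup>2))"
        using C K(1) by (simp add: abs_mult mult.assoc)
    qed
  qed
qed

lemma abs_le_one_plus_square: "\<bar>s\<bar> \<le> 1 + s\<^sup>2" for s :: real
  using sum_squares_bound[of s 1] sum_squares_bound[of "-s" 1]
  by (auto simp: abs_if power2_eq_square)

lemma integrable_gauss:
  assumes "Re m > 0"
  shows "integrable lborel (gauss m \<gamma>)" "integrable lborel (\<lambda>s. of_real s * gauss m \<gamma> s)"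
    "integrable lborel (\<lambda>s. of_real (s\<^sup>2) * gauss m \<gamma> s)"
proof -
  show "integrable lborel (gauss m \<gamma>)"
    using integrable_mult_gauss[OF assms, of "\<lambda>_. 1" 1] by simp
  show "integrable lborel (\<lambda>s. of_real s * gauss m \<gamma> s)"
    by (rule integrable_mult_gauss[OF assms, of _ 1])
      (auto intro!: continuous_intros abs_le_one_plus_square)
  show "integrable lborel (\<lambda>s. of_real (s\<^sup>2) * gauss m \<gamma> s)"
    by (rule integrable_mult_gauss[OF assms, of _ 1]) (auto intro!: continuous_intros simp: norm_power)
qed

lemma tendsto_mult_gauss_0:
  fixes p :: "real \<Rightarrow> complex"
  assumes "Re m > 0" and p: "\<And>s. norm (p s) \<le> C * (1 + s\<^sup>2)" and F: "F = at_top \<or> F = at_bot"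
  shows "((\<lambda>s. p s * gauss m \<gamma> s) \<longlongrightarrow> 0) F"
proof -
  obtain K where K: "K \<ge> 0"
    "\<And>s. (1 + s\<^sup>2) * norm (gauss m \<gamma> s) \<le> K * exp (- (Re m / 2) * s\<^sup>2)"
    using gauss_bound[OF assms(1), of "norm \<gamma>"] by (metis order_refl)
  have C: "C \<ge> 0" using order_trans[OF norm_ge_zero p[of 0]] by simp
  define c where "c = Re m / 2"
  have c: "c > 0" using assms(1) by (simp add: c_def)
  have "norm (p s * gauss m \<gamma> s) \<le> C * (K * exp (- c * s\<^sup>2))" for s
  proof -
    have "norm (p s * gauss m \<gamma> s) \<le> C * (1 + s\<^sup>2) * norm (gauss m \<gamma> s)"
      by (simp add: norm_mult mult_right_mono p)
    also have "\<dots> \<le> C * (K * exp (- c * s\<^sup>2))"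
      using mult_left_mono[OF K(2) C] by (simp add: mult.assoc c_def)
    finally show ?thesis .
  qed
  moreover have "((\<lambda>s. C * (K * exp (- c * s\<^sup>2))) \<longlongrightarrow> 0) F"
    using F c by (elim disjE) (hypsubst, real_asymp)+
  ultimately show ?thesis by (rule Lim_null_comparison[OF always_eventually[OF allI]])
qed

lemma gauss_has_vector_derivative:
  "(gauss m \<gamma> has_vector_derivative (- 2 * m * of_real s + \<gamma>) * gauss m \<gamma> s) (at s)"
proof -
  have "((\<lambda>z. exp (- m * z\<^sup>2 + \<gamma> * z)) has_field_derivative
      (- 2 * m * of_real s + \<gamma>) * exp (- m * (of_real s)\<^sup>2 + \<gamma> * of_real s)) (at (of_real s))"
    by (auto intro!: derivative_eq_intros simp: power2_eq_square algebra_simps)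
  from has_vector_derivative_real_field[OF this] show ?thesis
    by (simp add: gauss_def[abs_def])
qed

text \<open>These come from integrating the derivatives of the Gaussian and of s times the Gaussian.
  Read with differentiation under the integral sign, they are differential equations in \<gamma> and
  in \<open>m\<close>.\<close>

lemma gauss_by_parts:
  assumes "Re m > 0"
  shows "2 * m * (LINT s|lborel. of_real s * gauss m \<gamma> s) = \<gamma> * (LINT s|lborel. gauss m \<gamma> s)"
    and "2 * m * (LINT s|lborel. of_real (s\<^sup>2) * gauss m 0 s) = (LINT s|lborel. gauss m 0 s)"
proof -
  let ?f = "\<lambda>s. \<gamma> * gauss m \<gamma> s" and ?g = "\<lambda>s. 2 * m * (of_real s * gauss m \<gamma> s)"
  have int: "integrable lborel ?f" "integrable lborel ?g"
    by (intro integrable_mult_right integrable_gauss assms)+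
  have "(LINT s|lborel. ?f s - ?g s) = 0"
  proof (rule integral_vector_derivative_eq_0[where F = "gauss m \<gamma>"])
    show "(gauss m \<gamma> has_vector_derivative ?f s - ?g s) (at s)" for s
      by (rule has_vector_derivative_eq_rhs[OF gauss_has_vector_derivative]) (simp add: algebra_simps)
    show "(gauss m \<gamma> \<longlongrightarrow> 0) at_top" "(gauss m \<gamma> \<longlongrightarrow> 0) at_bot"
      using tendsto_mult_gauss_0[OF assms, of "\<lambda>_. 1" 1] by auto
    show "integrable lborel (\<lambda>s. ?f s - ?g s)"
      by (intro Bochner_Integration.integrable_diff int)
  qed (intro continuous_intros)
  then have "(LINT s|lborel. ?f s) - (LINT s|lborel. ?g s) = 0"
    by (rule trans[OF Bochner_Integration.integral_diff[OF int, symmetric]])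
  moreover have "(LINT s|lborel. ?f s) = \<gamma> * (LINT s|lborel. gauss m \<gamma> s)"
    by (rule integral_mult_right_zero)
  moreover have "(LINT s|lborel. ?g s) = 2 * m * (LINT s|lborel. of_real s * gauss m \<gamma> s)"
    by (rule integral_mult_right_zero)
  ultimately show "2 * m * (LINT s|lborel. of_real s * gauss m \<gamma> s) = \<gamma> * (LINT s|lborel. gauss m \<gamma> s)"
    by (metis right_minus_eq)
  let ?f = "\<lambda>s. gauss m 0 s" and ?g = "\<lambda>s. 2 * m * (of_real (s\<^sup>2) * gauss m 0 s)"
  have int: "integrable lborel ?f" "integrable lborel ?g"
    by (intro integrable_mult_right integrable_gauss assms)+
  have "(LINT s|lborel. ?f s - ?g s) = 0"
  proof (rule integral_vector_derivative_eq_0[where F = "\<lambda>s. of_real s * gauss m 0 s"])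
    have "((\<lambda>s. of_real s * gauss m 0 s) has_vector_derivative
        of_real s * ((- 2 * m * of_real s + 0) * gauss m 0 s) + 1 * gauss m 0 s) (at s)" for s
      by (intro has_vector_derivative_mult gauss_has_vector_derivative)
         (rule has_vector_derivative_real_field[OF DERIV_ident])
    then show "((\<lambda>s. of_real s * gauss m 0 s) has_vector_derivative ?f s - ?g s) (at s)" for s
      by (rule has_vector_derivative_eq_rhs) (simp add: power2_eq_square)
    show "((\<lambda>s. of_real s * gauss m 0 s) \<longlongrightarrow> 0) at_top" "((\<lambda>s. of_real s * gauss m 0 s) \<longlongrightarrow> 0) at_bot"
      using tendsto_mult_gauss_0[OF assms, of of_real 1] abs_le_one_plus_square by auto
    show "integrable lborel (\<lambda>s. ?f s - ?g s)"
      by (intro Bochner_Integration.integrable_diff int)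
  qed (intro continuous_intros)
  then have "(LINT s|lborel. ?f s) - (LINT s|lborel. ?g s) = 0"
    by (rule trans[OF Bochner_Integration.integral_diff[OF int, symmetric]])
  moreover have "(LINT s|lborel. ?g s) = 2 * m * (LINT s|lborel. of_real (s\<^sup>2) * gauss m 0 s)"
    by (rule integral_mult_right_zero)
  ultimately show "2 * m * (LINT s|lborel. of_real (s\<^sup>2) * gauss m 0 s) = (LINT s|lborel. gauss m 0 s)"
    by (metis right_minus_eq)
qed

text \<open>Stating the square avoids a branch of the square root of a complex \<open>m\<close>, and
  it is all that is needed: each complex coordinate contributes two real integrals with the same
  \<open>m\<close>.\<close>

lemma integral_gauss_0_square:
  assumes "Re m > 0"
  shows "(LINT s|lborel. gauss m 0 s)\<^sup>2 = of_real pi / m"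
proof -
  \<comment> \<open>The half-plane has to contain both \<open>m\<close> and the reference point 1,
    where the integral is known.\<close>
  define \<mu> where "\<mu> = min 1 (Re m)"
  have \<mu>: "\<mu> > 0" using assms by (simp add: \<mu>_def)
  define S where "S = {z. \<mu> \<le> Re z}"
  have S: "convex S" "m \<in> S" "1 \<in> S"
    unfolding S_def using convex_halfspace_Re_ge[of \<mu>] by (auto simp: \<mu>_def)
  have pos: "Re z > 0" if "z \<in> S" for z using that \<mu> by (simp add: S_def)
  obtain K where K: "K \<ge> 0" "\<And>z s. z \<in> S \<Longrightarrow>
      (1 + s\<^sup>2) * norm (gauss z 0 s) \<le> K * exp (- (\<mu> / 2) * s\<^sup>2)"
    by (rule gauss_bound[OF \<mu>, of 0]) (rule that, auto simp: S_def)
  define G where "G z = (LINT s|lborel. gauss z 0 s)" for z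
  have dG: "(G has_field_derivative - (G z / (2 * z))) (at z within S)" if z: "z \<in> S" for z
  proof -
    have "((\<lambda>z. LINT s|lborel. gauss z 0 s) has_field_derivative
        (LINT s|lborel. - (of_real (s\<^sup>2) * gauss z 0 s))) (at z within S)"
    proof (rule DERIV_integral[OF S(1) z, where w = "\<lambda>s. K * exp (- (\<mu> / 2) * s\<^sup>2)"])
      fix t s assume t: "t \<in> S"
      show "integrable lborel (gauss t 0)" by (intro integrable_gauss pos t)
      show "((\<lambda>t. gauss t 0 s) has_field_derivative - (of_real (s\<^sup>2) * gauss t 0 s)) (at t within S)"
        unfolding gauss_def by (auto intro!: derivative_eq_intros)
      have "norm (- (of_real (s\<^sup>2) * gauss t 0 s)) \<le> (1 + s\<^sup>2) * norm (gauss t 0 s)"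
        unfolding norm_minus_cancel norm_mult
        by (intro mult_right_mono) (auto simp: norm_power)
      also note K(2)[OF t]
      finally show "norm (- (of_real (s\<^sup>2) * gauss t 0 s)) \<le> K * exp (- (\<mu> / 2) * s\<^sup>2)" .
    next
      show "integrable lborel (\<lambda>s. K * exp (- (\<mu> / 2) * s\<^sup>2))"
        using \<mu> by (intro integrable_mult_right integrable_exp_neg_square) simp
      show "(\<lambda>s. - (of_real (s\<^sup>2) * gauss z 0 s)) \<in> borel_measurable lborel"
        using integrable_gauss(3)[OF pos[OF z], of 0] by (intro borel_measurable_uminus) auto
    qed
    moreover have "(LINT s|lborel. - (of_real (s\<^sup>2) * gauss z 0 s)) = - (G z / (2 * z))"
    proof -
      have "z \<noteq> 0" using pos[OF z] by auto
      with gauss_by_parts(2)[OF pos[OF z]] show ?thesis by (simp add: G_def field_simps)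
    qed
    ultimately show ?thesis by (simp add: G_def[abs_def])
  qed
  \<comment> \<open>By \<open>dG\<close> the derivative of G is - G / (2 z), which makes this
    product constant.\<close>
  have "\<exists>c. \<forall>z\<in>S. z * (G z)\<^sup>2 = c"
  proof (rule has_field_derivative_zero_constant[OF S(1)])
    fix z assume z: "z \<in> S"
    then have "z \<noteq> 0" using pos by force
    with z show "((\<lambda>z. z * (G z)\<^sup>2) has_field_derivative 0) (at z within S)"
      by (auto intro!: derivative_eq_intros dG simp: field_simps power2_eq_square)
  qed
  then have "m * (G m)\<^sup>2 = 1 * (G 1)\<^sup>2" using S by metis
  also have "G 1 = of_real (LINT s|lborel. exp (- s\<^sup>2))"
    unfolding G_def gauss_def integral_complex_of_real[symmetric] by (simp add: exp_of_real[symmetric])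
  finally have "m * (G m)\<^sup>2 = of_real pi"
    by (simp add: integral_exp_neg_square flip: of_real_power)
  moreover have "m \<noteq> 0" using assms by auto
  ultimately show ?thesis by (simp add: G_def field_simps)
qed

text \<open>A differential equation in the linear coefficient replaces a shift of contour: G' = z G
  / (2 m), with integrating factor exp (- z^2 / (4 m)).\<close>

lemma integral_gauss_shift:
  assumes "Re m > 0"
  shows "(LINT s|lborel. gauss m \<gamma> s) = exp (\<gamma>\<^sup>2 / (4 * m)) * (LINT s|lborel. gauss m 0 s)"
proof -
  define S where "S = cball (0::complex) (norm \<gamma>)"
  have S: "convex S" "\<gamma> \<in> S" "0 \<in> S"
    unfolding S_def by auto
  have "m \<noteq> 0" using assms by auto
  obtain K where K: "K \<ge> 0" "\<And>z s. z \<in> S \<Longrightarrow>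
      (1 + s\<^sup>2) * norm (gauss m z s) \<le> K * exp (- (Re m / 2) * s\<^sup>2)"
    by (rule gauss_bound[OF assms, of "norm \<gamma>"]) (rule that, auto simp: S_def)
  define G where "G z = (LINT s|lborel. gauss m z s)" for z
  have dG: "(G has_field_derivative (z / (2 * m) * G z)) (at z within S)" if z: "z \<in> S" for z
  proof -
    have "((\<lambda>z. LINT s|lborel. gauss m z s) has_field_derivative
        (LINT s|lborel. of_real s * gauss m z s)) (at z within S)"
    proof (rule DERIV_integral[OF S(1) z, where w = "\<lambda>s. K * exp (- (Re m / 2) * s\<^sup>2)"])
      fix t s assume t: "t \<in> S"
      show "integrable lborel (gauss m t)" by (intro integrable_gauss assms)
      show "((\<lambda>t. gauss m t s) has_field_derivative of_real s * gauss m t s) (at t within S)"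
        unfolding gauss_def by (auto intro!: derivative_eq_intros)
      have "norm (of_real s * gauss m t s) \<le> (1 + s\<^sup>2) * norm (gauss m t s)"
        unfolding norm_mult using abs_le_one_plus_square by (intro mult_right_mono) auto
      also note K(2)[OF t]
      finally show "norm (of_real s * gauss m t s) \<le> K * exp (- (Re m / 2) * s\<^sup>2)" .
    next
      show "integrable lborel (\<lambda>s. K * exp (- (Re m / 2) * s\<^sup>2))"
        using assms by (intro integrable_mult_right integrable_exp_neg_square) simp
      show "(\<lambda>s. of_real s * gauss m z s) \<in> borel_measurable lborel"
        using integrable_gauss(2)[OF assms] by auto
    qed
    moreover have "(LINT s|lborel. of_real s * gauss m z s) = z / (2 * m) * G z"
      using gauss_by_parts(1)[OF assms, of z] \<open>m \<noteq> 0\<close> by (auto simp: G_def field_simps)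
    ultimately show ?thesis by (simp add: G_def[abs_def])
  qed
  have "\<exists>c. \<forall>z\<in>S. exp (- (z\<^sup>2 / (4 * m))) * G z = c"
  proof (rule has_field_derivative_zero_constant[OF S(1)])
    fix z assume z: "z \<in> S"
    with \<open>m \<noteq> 0\<close> show "((\<lambda>z. exp (- (z\<^sup>2 / (4 * m))) * G z) has_field_derivative 0) (at z within S)"
      by (auto intro!: derivative_eq_intros dG simp: field_simps power2_eq_square)
  qed
  then have "exp (- (\<gamma>\<^sup>2 / (4 * m))) * G \<gamma> = exp (- (0\<^sup>2 / (4 * m))) * G 0" using S by metis
  then show ?thesis by (simp add: G_def exp_minus field_simps)
qed

section \<open>Gaussian integrals over the complex plane\<close>

text \<open>Lebesgue measure on the plane is the image of a product measure indexed by the basis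
  vectors 1 and i. Hence the two factors are packed into a family \<open>H\<close> over the basis
  before the product formula is applied.\<close>

lemma integral_complex_product:
  fixes h :: "complex \<Rightarrow> 'a :: {real_normed_field, banach, second_countable_topology}"
  assumes h: "h \<in> borel_measurable borel" and F: "integrable lborel F" "integrable lborel G"
    and eq: "\<And>x y. h (Complex x y) = F x * G y"
  shows "integrable lborel h" "integral\<^sup>L lborel h = integral\<^sup>L lborel F * integral\<^sup>L lborel G"
proof -
  interpret product_sigma_finite "\<lambda>_ :: complex. lborel :: real measure"
    by standard
  define H where "H b = (if b = 1 then F else G)" for b :: complex
  let ?P = "PiM Basis (\<lambda>_ :: complex. lborel :: real measure)"
  have eq': "(\<lambda>f. h (\<Sum>b\<in>Basis. f b *\<^sub>R b)) = (\<lambda>f. \<Prod>b\<in>Basis. H b (f b))"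
    by (auto simp: Basis_complex_def H_def complex_eq_iff eq[symmetric] intro!: arg_cong[of _ _ h])
  have meas: "(\<lambda>f. \<Sum>b\<in>Basis. f b *\<^sub>R b) \<in> ?P \<rightarrow>\<^sub>M (borel :: complex measure)"
    by measurable
  have H: "integrable lborel (H b)" for b
    using F by (simp add: H_def)
  have "integrable ?P (\<lambda>f. \<Prod>b\<in>Basis. H b (f b))"
    by (intro product_integrable_prod H) simp
  then show "integrable lborel h"
    by (subst lborel_eq, subst integrable_distr_eq[OF meas h], subst eq')
  have "integral\<^sup>L lborel h = integral\<^sup>L ?P (\<lambda>f. \<Prod>b\<in>Basis. H b (f b))"
    by (subst lborel_eq, subst integral_distr[OF meas h], subst eq') (rule refl)
  also have "\<dots> = (\<Prod>b\<in>Basis. integral\<^sup>L lborel (H b))"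
    by (intro product_integral_prod H) simp
  also have "\<dots> = integral\<^sup>L lborel F * integral\<^sup>L lborel G"
    by (simp add: Basis_complex_def H_def)
  finally show "integral\<^sup>L lborel h = integral\<^sup>L lborel F * integral\<^sup>L lborel G" .
qed

lemma integrable_exp_complex:
  fixes c K :: real
  assumes "c > 0" "K \<ge> 0"
  shows "integrable lborel (\<lambda>y::complex. exp (- c * (norm y)\<^sup>2 + K * norm y))"
proof -
  let ?g = "\<lambda>s::real. exp (- c * s\<^sup>2 + K * \<bar>s\<bar>)"
  obtain C where C: "C \<ge> 0" "\<And>s::real. (1 + s\<^sup>2) * ?g s \<le> C * exp (- (c / 2) * s\<^sup>2)"
    using poly_gauss_bound[OF assms(1)] by metis
  have g: "integrable lborel ?g"
  proof (rule Bochner_Integration.integrable_bound)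
    show "integrable lborel (\<lambda>s. C * exp (- (c / 2) * s\<^sup>2))"
      using assms by (intro integrable_mult_right integrable_exp_neg_square) simp
    have "?g s \<le> (1 + s\<^sup>2) * ?g s" for s by simp
    then have "?g s \<le> C * exp (- (c / 2) * s\<^sup>2)" for s
      using C(2) by (rule order_trans)
    then show "AE s in lborel. norm (?g s) \<le> norm (C * exp (- (c / 2) * s\<^sup>2))"
      using C(1) by simp
  qed simp
  have "integrable lborel (\<lambda>y::complex. ?g (Re y) * ?g (Im y))"
    by (rule integral_complex_product(1)[OF _ g g]) simp_all
  then show ?thesis
  proof (rule Bochner_Integration.integrable_bound)
    show "AE y in lborel. norm (exp (- c * (norm y)\<^sup>2 + K * norm y)) \<le> norm (?g (Re y) * ?g (Im y))"
    proof (rule AE_I2)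
      fix y :: complex
      have "- c * (norm y)\<^sup>2 + K * norm y \<le> - c * (Re y)\<^sup>2 + K * \<bar>Re y\<bar> + (- c * (Im y)\<^sup>2 + K * \<bar>Im y\<bar>)"
        using mult_left_mono[OF cmod_le[of y] assms(2)] by (simp add: cmod_power2 algebra_simps)
      then show "norm (exp (- c * (norm y)\<^sup>2 + K * norm y)) \<le> norm (?g (Re y) * ?g (Im y))"
        by (simp flip: exp_add)
    qed
  qed simp
qed

text \<open>In real and imaginary parts the exponent separates with the same quadratic coefficient
  twice, so the squared real integral appears. The linear coefficients combine through (\<alpha> +
  \<beta>)^2 - (\<alpha> - \<beta>)^2 = 4 \<alpha> \<beta>.\<close>

lemma integral_gauss_complex:
  assumes \<kappa>: "\<kappa> > (0::real)" and m: "Re m > 0"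
  shows "(LINT y|lborel. exp (of_real \<kappa> * (- (cnj y * m * y) + \<alpha> * y + \<beta> * cnj y))) =
    of_real (pi / \<kappa>) / m * exp (of_real \<kappa> * (\<alpha> * \<beta> / m))"
proof -
  let ?m = "of_real \<kappa> * m" and ?g = "of_real \<kappa> * (\<alpha> + \<beta>)" and ?h = "\<i> * of_real \<kappa> * (\<alpha> - \<beta>)"
  have pos: "Re ?m > 0" using assms by simp
  have nz: "m \<noteq> 0" "\<kappa> \<noteq> 0" using assms by auto
  have "(LINT y|lborel. exp (of_real \<kappa> * (- (cnj y * m * y) + \<alpha> * y + \<beta> * cnj y)))
      = (LINT s|lborel. gauss ?m ?g s) * (LINT s|lborel. gauss ?m ?h s)"
  proof (rule integral_complex_product(2)[OF _ integrable_gauss(1)[OF pos] integrable_gauss(1)[OF pos]])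
    show "(\<lambda>y. exp (of_real \<kappa> * (- (cnj y * m * y) + \<alpha> * y + \<beta> * cnj y))) \<in> borel_measurable borel"
      by (intro borel_measurable_continuous_onI continuous_intros)
    fix x y
    have c: "Complex x y = of_real x + \<i> * of_real y" "cnj (Complex x y) = of_real x - \<i> * of_real y"
      by (simp_all add: complex_eq_iff)
    have "of_real \<kappa> * (- (cnj (Complex x y) * m * Complex x y) + \<alpha> * Complex x y + \<beta> * cnj (Complex x y))
       = (- ?m * of_real (x\<^sup>2) + ?g * of_real x) + (- ?m * of_real (y\<^sup>2) + ?h * of_real y)"
      unfolding c by (simp add: power2_eq_square algebra_simps)
    then show "exp (of_real \<kappa> * (- (cnj (Complex x y) * m * Complex x y) + \<alpha> * Complex x y + \<beta> * cnj (Complex x y)))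
      = gauss ?m ?g x * gauss ?m ?h y"
      by (simp only: gauss_def exp_add)
  qed
  also have "\<dots> = (exp (?g\<^sup>2 / (4 * ?m)) * exp (?h\<^sup>2 / (4 * ?m))) * (LINT s|lborel. gauss ?m 0 s)\<^sup>2"
    by (simp add: integral_gauss_shift[OF pos, of ?g] integral_gauss_shift[OF pos, of ?h] power2_eq_square)
  also have "exp (?g\<^sup>2 / (4 * ?m)) * exp (?h\<^sup>2 / (4 * ?m)) = exp (of_real \<kappa> * (\<alpha> * \<beta> / m))"
    unfolding exp_add[symmetric] using nz
    by (intro arg_cong[of _ _ exp]) (simp add: field_simps power2_eq_square)
  also have "(LINT s|lborel. gauss ?m 0 s)\<^sup>2 = of_real (pi / \<kappa>) / m"
    using integral_gauss_0_square[OF pos] by simp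
  finally show ?thesis by (simp only: mult.commute)
qed

section \<open>From one coordinate to C^n by Schur complements\<close>

text \<open>The product runs over whole coordinates instead of the real basis, so that a later
  induction can integrate out one complex variable at a time. Agreement on boxes suffices.\<close>

lemma lborel_vec_eq:
  "(lborel :: (('a::euclidean_space) ^ 'n) measure) =
    distr (PiM UNIV (\<lambda>_. lborel)) borel (\<lambda>f. \<chi> i. f i)"
proof (rule lborel_eqI)
  interpret product_sigma_finite "\<lambda>_ :: 'n. lborel :: 'a measure"
    by standard
  have meas: "(\<lambda>f. \<chi> i. f i) \<in> PiM UNIV (\<lambda>_. lborel :: 'a measure) \<rightarrow>\<^sub>M (borel :: ('a ^ 'n) measure)"
    by (subst borel_measurable_euclidean_space) (auto simp: Basis_vec_def inner_axis)
  fix l u :: "'a ^ 'n"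
  assume le: "\<And>b. b \<in> Basis \<Longrightarrow> l \<bullet> b \<le> u \<bullet> b"
  have le': "l $ i \<bullet> b \<le> u $ i \<bullet> b" if "b \<in> Basis" for i b
    using le[of "axis i b"] that by (simp add: inner_axis)
  have "emeasure (distr (PiM UNIV (\<lambda>_. lborel)) borel (\<lambda>f. \<chi> i. f i)) (box l u) =
      emeasure (PiM UNIV (\<lambda>_. lborel)) (\<Pi>\<^sub>E i\<in>UNIV. box (l $ i) (u $ i))"
    by (subst emeasure_distr[OF meas]) (auto simp: mem_box Basis_vec_def inner_axis space_PiM PiE_iff
        intro!: arg_cong2[of _ _ _ _ emeasure])
  also have "\<dots> = (\<Prod>i\<in>UNIV. emeasure lborel (box (l $ i) (u $ i)))"
    by (intro emeasure_PiM) auto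
  also have "\<dots> = (\<Prod>i\<in>UNIV. ennreal (\<Prod>b\<in>Basis. (u $ i - l $ i) \<bullet> b))"
    by (intro prod.cong refl emeasure_lborel_box) (rule le')
  also have "\<dots> = ennreal (\<Prod>i\<in>UNIV. \<Prod>b\<in>Basis. (u $ i - l $ i) \<bullet> b)"
    by (intro prod_ennreal prod_nonneg) (auto simp: inner_diff_left le')
  also have "(\<Prod>i\<in>UNIV. \<Prod>b\<in>Basis. (u $ i - l $ i) \<bullet> b) = (\<Prod>b\<in>Basis. (u - l) \<bullet> b)"
  proof -
    have B: "Basis = (\<lambda>(i, b). axis i b) ` (UNIV \<times> Basis :: ('n \<times> 'a) set)"
      by (auto simp: Basis_vec_def)
    have inj: "inj_on (\<lambda>(i, b). axis i b) (UNIV \<times> Basis :: ('n \<times> 'a) set)"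
      by (auto simp: inj_on_def axis_eq_axis nonzero_Basis)
    show ?thesis
      by (subst B, subst prod.reindex[OF inj]) (simp add: prod.cartesian_product inner_axis case_prod_beta)
  qed
  finally show "emeasure (distr (PiM UNIV (\<lambda>_. lborel)) borel (\<lambda>f. \<chi> i. f i)) (box l u) =
    ennreal (\<Prod>b\<in>Basis. (u - l) \<bullet> b)" .
qed simp

text \<open>One elimination step on both sides: \<open>L\<close> normalises the pivot row and clears
  the rest of column \<open>i\<close>, then \<open>transpose R\<close> clears the rest of row
  \<open>i\<close>.\<close>

lemma det_pivot:
  fixes M :: "'a::field ^ 'n ^ 'n"
  assumes m: "M $ i $ i \<noteq> 0"
  shows "det M = M $ i $ i * det (\<chi> j k. if j = i \<or> k = i then if j = k then 1 else 0
      else M $ j $ k - M $ j $ i * M $ i $ k / M $ i $ i)"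
    (is "_ = _ * det ?N")
proof -
  let ?m = "M $ i $ i"
  define x where "x = (\<chi> j. if j = i then 1 / ?m else - M $ j $ i / ?m)"
  define y where "y = (\<chi> k. if k = i then 1 else - M $ i $ k / ?m)"
  define L where "L = (\<chi> j k. if k = i then x $ j else if j = k then 1 else 0)"
  define R where "R = (\<chi> j k. if k = i then y $ j else if j = k then 1 else 0)"
  \<comment> \<open>Cramer's rule for the identity matrix.\<close>
  have "det (\<chi> j k. if k = i then w $ j else if j = k then 1 else 0) = w $ i" for w :: "'a^'n"
  proof -
    have "(\<chi> j k. if k = i then w $ j else if j = k then 1 else 0) =
        (\<chi> j k. if k = i then (mat 1 *v w) $ j else (mat 1 :: 'a^'n^'n) $ j $ k)"
      unfolding matrix_vector_mul_lid by (simp add: mat_def vec_eq_iff)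
    then show ?thesis by (simp add: cramer_lemma)
  qed
  then have L: "det L = 1 / ?m" and R: "det R = 1"
    unfolding L_def R_def by (simp_all add: x_def y_def)
  have LM: "(L ** M) $ j $ k = x $ j * M $ i $ k + (if j = i then 0 else M $ j $ k)" for j k
  proof -
    have "(L ** M) $ j $ k = (\<Sum>l\<in>UNIV. L $ j $ l * M $ l $ k)"
      by (simp add: matrix_matrix_mult_def)
    also have "\<dots> =
        (\<Sum>l\<in>UNIV. (if l = i then x $ j * M $ i $ k else 0) + (if l = j then if j = i then 0 else M $ j $ k else 0))"
      unfolding L_def by (intro sum.cong) auto
    finally show ?thesis by (simp add: sum.distrib)
  qed
  have "(L ** M ** transpose R) $ j $ k =
      (L ** M) $ j $ i * y $ k + (if k = i then 0 else (L ** M) $ j $ k)" for j k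
  proof -
    have "(L ** M ** transpose R) $ j $ k = (\<Sum>l\<in>UNIV. (L ** M) $ j $ l * R $ k $ l)"
      by (simp add: matrix_matrix_mult_def[of "L ** M"] transpose_def)
    also have "\<dots> =
        (\<Sum>l\<in>UNIV. (if l = i then (L ** M) $ j $ i * y $ k else 0)
          + (if l = k then if k = i then 0 else (L ** M) $ j $ k else 0))"
      unfolding R_def by (intro sum.cong) auto
    finally show ?thesis by (simp add: sum.distrib)
  qed
  then have "L ** M ** transpose R = ?N"
    using m by (auto simp: vec_eq_iff LM x_def y_def field_simps)
  moreover have "det (L ** M ** transpose R) = det M / ?m"
    by (simp add: det_mul L R)
  ultimately have "det ?N = det M / ?m" by (simp only:)
  with m show ?thesis by simp
qed

text \<open>Coercivity decouples the coordinates: the modulus is at most a product of integrable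
  functions of one variable each.\<close>

lemma integrable_gauss_PiM:
  fixes A :: "'n \<Rightarrow> 'n \<Rightarrow> complex"
  assumes S: "finite S" and \<kappa>: "\<kappa> > (0::real)" and \<epsilon>: "\<epsilon> > 0"
    and coer: "\<And>u. \<epsilon> * (\<Sum>i\<in>S. (norm (u i))\<^sup>2) \<le> Re (\<Sum>i\<in>S. \<Sum>j\<in>S. cnj (u i) * A i j * u j)"
  shows "integrable (PiM S (\<lambda>_. lborel)) (\<lambda>x. exp (of_real \<kappa> * (- (\<Sum>i\<in>S. \<Sum>j\<in>S. cnj (x i) * A i j * x j)
      + (\<Sum>i\<in>S. a i * x i) + (\<Sum>i\<in>S. b i * cnj (x i)))))"
    (is "integrable ?P ?E")
proof (rule Bochner_Integration.integrable_bound)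
  interpret product_sigma_finite "\<lambda>_ :: 'n. lborel :: complex measure"
    by standard
  let ?g = "\<lambda>i y. exp (- (\<kappa> * \<epsilon>) * (norm (y::complex))\<^sup>2 + \<kappa> * (norm (a i) + norm (b i)) * norm y)"
  show "integrable ?P (\<lambda>x. \<Prod>i\<in>S. ?g i (x i))"
    using \<kappa> \<epsilon> by (intro product_integrable_prod S integrable_exp_complex) auto
  have *: "(\<lambda>x. x i) \<in> ?P \<rightarrow>\<^sub>M (borel :: complex measure)" if "i \<in> S" for i
    using measurable_component_singleton[OF that, of "\<lambda>_. lborel :: complex measure"] by simp
  have cnj_meas: "(\<lambda>x. cnj (x i)) \<in> ?P \<rightarrow>\<^sub>M borel" if "i \<in> S" for i
    by (rule measurable_compose[OF *[OF that]])
       (intro borel_measurable_continuous_onI continuous_intros)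
  have "(\<lambda>x. (- (\<Sum>i\<in>S. \<Sum>j\<in>S. cnj (x i) * A i j * x j)
      + (\<Sum>i\<in>S. a i * x i) + (\<Sum>i\<in>S. b i * cnj (x i)))) \<in> borel_measurable ?P"
    by (intro borel_measurable_add borel_measurable_uminus borel_measurable_sum borel_measurable_times
        borel_measurable_const * cnj_meas)
  moreover have "(\<lambda>z::complex. exp (of_real \<kappa> * z)) \<in> borel_measurable borel"
    by (intro borel_measurable_continuous_onI continuous_intros)
  ultimately show "?E \<in> borel_measurable ?P"
    by (rule measurable_compose)
  show "AE x in ?P. norm (?E x) \<le> norm (\<Prod>i\<in>S. ?g i (x i))"
  proof (rule AE_I2)
    fix x
    have "Re (- (\<Sum>i\<in>S. \<Sum>j\<in>S. cnj (x i) * A i j * x j) + (\<Sum>i\<in>S. a i * x i) + (\<Sum>i\<in>S. b i * cnj (x i)))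
        \<le> - \<epsilon> * (\<Sum>i\<in>S. (norm (x i))\<^sup>2) + (\<Sum>i\<in>S. norm (a i) * norm (x i)) + (\<Sum>i\<in>S. norm (b i) * norm (x i))"
    proof -
      have "Re (\<Sum>i\<in>S. a i * x i) \<le> (\<Sum>i\<in>S. norm (a i) * norm (x i))"
        unfolding Re_sum by (intro sum_mono) (metis complex_Re_le_cmod norm_mult)
      moreover have "Re (\<Sum>i\<in>S. b i * cnj (x i)) \<le> (\<Sum>i\<in>S. norm (b i) * norm (x i))"
        unfolding Re_sum by (intro sum_mono) (metis complex_Re_le_cmod norm_mult complex_mod_cnj)
      ultimately show ?thesis using coer[of x] by simp
    qed
    also have "\<dots> = (\<Sum>i\<in>S. - \<epsilon> * (norm (x i))\<^sup>2 + (norm (a i) + norm (b i)) * norm (x i))"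
      by (simp add: sum.distrib sum_distrib_left ring_distribs sum_negf sum_subtractf)
    finally have "norm (?E x) \<le> exp (\<kappa> * (\<Sum>i\<in>S. - \<epsilon> * (norm (x i))\<^sup>2 + (norm (a i) + norm (b i)) * norm (x i)))"
      using \<kappa> by (simp del: minus_complex.sel plus_complex.sel uminus_complex.sel)
    also have "\<dots> = (\<Prod>i\<in>S. ?g i (x i))"
      using S by (simp add: exp_sum sum_distrib_left algebra_simps)
    finally show "norm (?E x) \<le> norm (\<Prod>i\<in>S. ?g i (x i))"
      by (simp add: prod_nonneg)
  qed
qed

lemma sum_insert_form:
  fixes A :: "'n \<Rightarrow> 'n \<Rightarrow> 'a::comm_ring"
  assumes "finite S" "i \<notin> S"
  shows "(\<Sum>j\<in>insert i S. \<Sum>k\<in>insert i S. y j * A j k * x k) =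
    y i * A i i * x i + y i * (\<Sum>k\<in>S. A i k * x k) + (\<Sum>j\<in>S. y j * A j i) * x i
     + (\<Sum>j\<in>S. \<Sum>k\<in>S. y j * A j k * x k)"
  using assms by (simp add: sum.distrib sum_distrib_left sum_distrib_right mult.assoc)

lemma sum_schur_form:
  fixes A :: "'n \<Rightarrow> 'n \<Rightarrow> 'a::field"
  shows "(\<Sum>j\<in>S. \<Sum>k\<in>S. y j * (A j k - B j * C k / m) * x k) =
    (\<Sum>j\<in>S. \<Sum>k\<in>S. y j * A j k * x k) - (\<Sum>j\<in>S. y j * B j) * (\<Sum>k\<in>S. C k * x k) / m"
  by (simp add: sum_product sum_divide_distrib algebra_simps flip: sum_subtractf)

text \<open>
  Integrating out one coordinate replaces \<open>M\<close> by its Schur complement. To keep the index type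
  fixed, \<open>M\<close> is extended by the identity outside \<open>S\<close>.
\<close>

lemma integral_gauss_PiM:
  fixes M :: "complex ^ 'n ^ 'n"
  assumes S: "finite S" and \<kappa>: "\<kappa> > (0::real)" and \<epsilon>: "\<epsilon> > 0"
    and "\<And>i j. i \<notin> S \<or> j \<notin> S \<Longrightarrow> M $ i $ j = (if i = j then 1 else 0)"
    and "\<And>u. \<epsilon> * (\<Sum>i\<in>S. (norm (u i))\<^sup>2) \<le> Re (\<Sum>i\<in>S. \<Sum>j\<in>S. cnj (u i) * M $ i $ j * u j)"
    and "\<And>i. i \<in> S \<Longrightarrow> (\<Sum>j\<in>S. M $ i $ j * v j) = b i"
  shows "(LINT x|PiM S (\<lambda>_. lborel). exp (of_real \<kappa> * (- (\<Sum>i\<in>S. \<Sum>j\<in>S. cnj (x i) * M $ i $ j * x j)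
      + (\<Sum>i\<in>S. a i * x i) + (\<Sum>i\<in>S. b i * cnj (x i)))))
    = of_real (pi / \<kappa>) ^ card S / det M * exp (of_real \<kappa> * (\<Sum>i\<in>S. a i * v i))"
  using S assms(4-)
proof (induction S arbitrary: M a b rule: finite_induct)
  case empty
  then have "M = mat 1" by (simp add: vec_eq_iff mat_def)
  then show ?case by (simp add: PiM_empty lebesgue_integral_count_space_finite)
next
  case (insert i S)
  interpret product_sigma_finite "\<lambda>_ :: 'n. lborel :: complex measure"
    by standard
  note M_out = insert.prems(1) and coer = insert.prems(2) and sol = insert.prems(3)
  let ?P = "PiM S (\<lambda>_. lborel :: complex measure)"
  define m where "m = M $ i $ i"
  define N where "N = (\<chi> j k. if j = i \<or> k = i then if j = k then 1 else 0
      else M $ j $ k - M $ j $ i * M $ i $ k / m)"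
  \<comment> \<open>\<open>a'\<close> and \<open>b'\<close> are the linear coefficients that remain
    after completing the square in coordinate \<open>i\<close>.\<close>
  define a' where "a' k = a k - a i * M $ i $ k / m" for k
  define b' where "b' j = b j - b i * M $ j $ i / m" for j
  \<comment> \<open>Coercivity tested on the unit vector of coordinate \<open>i\<close> shows that
    the pivot is admissible.\<close>
  have "Re m \<ge> \<epsilon>"
  proof -
    define e where "e j = (if j = i then 1 else 0 :: complex)" for j
    have e: "e i = 1" "\<And>j. j \<in> S \<Longrightarrow> e j = 0" using insert.hyps by (auto simp: e_def)
    have "\<epsilon> * (\<Sum>j\<in>insert i S. (norm (e j))\<^sup>2) = \<epsilon>"
      using insert.hyps by (simp add: e)
    moreover have "(\<Sum>j\<in>insert i S. \<Sum>k\<in>insert i S. cnj (e j) * M $ j $ k * e k) = m"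
      using insert.hyps unfolding m_def by (simp add: sum_insert_form e)
    ultimately show ?thesis using coer[of e] by (simp only:)
  qed
  then have m: "Re m > 0" "m \<noteq> 0" using \<epsilon> by auto
  have NS: "N $ j $ k = M $ j $ k - M $ j $ i * M $ i $ k / m" if "j \<in> S" "k \<in> S" for j k
    using that insert.hyps by (auto simp: N_def)
  have QN: "(\<Sum>j\<in>S. \<Sum>k\<in>S. y j * N $ j $ k * x k) =
      (\<Sum>j\<in>S. \<Sum>k\<in>S. y j * M $ j $ k * x k) - (\<Sum>j\<in>S. y j * M $ j $ i) * (\<Sum>k\<in>S. M $ i $ k * x k) / m" for x y
    unfolding sum_schur_form[symmetric] by (intro sum.cong refl) (simp add: NS)
  have IH: "(LINT x|?P. exp (of_real \<kappa> * (- (\<Sum>j\<in>S. \<Sum>k\<in>S. cnj (x j) * N $ j $ k * x k)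
      + (\<Sum>j\<in>S. a' j * x j) + (\<Sum>j\<in>S. b' j * cnj (x j)))))
    = of_real (pi / \<kappa>) ^ card S / det N * exp (of_real \<kappa> * (\<Sum>j\<in>S. a' j * v j))"
  proof (rule insert.IH)
    show "N $ j $ k = (if j = k then 1 else 0)" if "j \<notin> S \<or> k \<notin> S" for j k
      using that M_out[of j k] M_out[of i k] M_out[of j i] by (auto simp: N_def)
    show "\<epsilon> * (\<Sum>j\<in>S. (norm (u j))\<^sup>2) \<le> Re (\<Sum>j\<in>S. \<Sum>k\<in>S. cnj (u j) * N $ j $ k * u k)" for u
    proof -
      \<comment> \<open>With this value in coordinate \<open>i\<close>, row \<open>i\<close> of M
        annihilates the extended vector, and the form of M there equals the form of the Schur
        complement at \<open>u\<close>. Coercivity is inherited with the same \<epsilon>.\<close>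
      define y where "y = - (\<Sum>k\<in>S. M $ i $ k * u k) / m"
      define w where "w = u(i := y)"
      have w: "w i = y" "\<And>j. j \<in> S \<Longrightarrow> w j = u j" using insert.hyps by (auto simp: w_def)
      have "\<epsilon> * (\<Sum>j\<in>S. (norm (u j))\<^sup>2) \<le> \<epsilon> * (\<Sum>j\<in>insert i S. (norm (w j))\<^sup>2)"
        using insert.hyps \<epsilon> by (simp add: w)
      also note coer
      also have "(\<Sum>j\<in>insert i S. \<Sum>k\<in>insert i S. cnj (w j) * M $ j $ k * w k) =
          (\<Sum>j\<in>S. \<Sum>k\<in>S. cnj (u j) * N $ j $ k * u k)"
        using m insert.hyps unfolding QN
        by (subst sum_insert_form) (simp_all add: w m_def[symmetric] y_def field_simps)
      finally show ?thesis .
    qed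
    \<comment> \<open>Eliminating the unknown of index \<open>i\<close> keeps the other components
      of a solution; hence \<open>v\<close> stays fixed throughout the induction.\<close>
    show "(\<Sum>k\<in>S. N $ j $ k * v k) = b' j" if j: "j \<in> S" for j
    proof -
      have e: "m * v i + (\<Sum>k\<in>S. M $ i $ k * v k) = b i" "M $ j $ i * v i + (\<Sum>k\<in>S. M $ j $ k * v k) = b j"
        using sol[of i] sol[of j] j insert.hyps by (simp_all add: m_def)
      have "(\<Sum>k\<in>S. N $ j $ k * v k) =
          (\<Sum>k\<in>S. M $ j $ k * v k) - M $ j $ i / m * (\<Sum>k\<in>S. M $ i $ k * v k)"
        by (simp add: NS j sum_distrib_left algebra_simps flip: sum_subtractf)
      then show ?thesis
        unfolding b'_def e[symmetric] using m by (simp add: field_simps)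
    qed
  qed
  have inner: "(LINT y|lborel. exp (of_real \<kappa> * (- (\<Sum>j\<in>insert i S. \<Sum>k\<in>insert i S. cnj ((x(i := y)) j) * M $ j $ k * (x(i := y)) k)
      + (\<Sum>j\<in>insert i S. a j * (x(i := y)) j) + (\<Sum>j\<in>insert i S. b j * cnj ((x(i := y)) j)))))
    = (of_real (pi / \<kappa>) / m * exp (of_real \<kappa> * (a i * b i / m))) *
      exp (of_real \<kappa> * (- (\<Sum>j\<in>S. \<Sum>k\<in>S. cnj (x j) * N $ j $ k * x k)
      + (\<Sum>j\<in>S. a' j * x j) + (\<Sum>j\<in>S. b' j * cnj (x j))))" (is "?lhs = ?rhs") for x
  proof -
    define p where "p = (\<Sum>j\<in>S. cnj (x j) * M $ j $ i)"
    define r where "r = (\<Sum>k\<in>S. M $ i $ k * x k)"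
    define c where "c = - (\<Sum>j\<in>S. \<Sum>k\<in>S. cnj (x j) * M $ j $ k * x k)
      + (\<Sum>j\<in>S. a j * x j) + (\<Sum>j\<in>S. b j * cnj (x j))"
    have *: "- (\<Sum>j\<in>insert i S. \<Sum>k\<in>insert i S. cnj ((x(i := y)) j) * M $ j $ k * (x(i := y)) k)
      + (\<Sum>j\<in>insert i S. a j * (x(i := y)) j) + (\<Sum>j\<in>insert i S. b j * cnj ((x(i := y)) j))
      = c + (- (cnj y * m * y) + (a i - p) * y + (b i - r) * cnj y)" for y
    proof -
      define w where "w = x(i := y)"
      have w: "w i = y" "\<And>j. j \<in> S \<Longrightarrow> w j = x j" using insert.hyps by (auto simp: w_def)
      show ?thesis
        unfolding w_def[symmetric] using insert.hyps
        by (subst sum_insert_form) (simp_all add: w m_def[symmetric] p_def r_def c_def algebra_simps)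
    qed
    have "?lhs = exp (of_real \<kappa> * c) * (LINT y|lborel. exp (of_real \<kappa> * (- (cnj y * m * y) + (a i - p) * y + (b i - r) * cnj y)))"
      unfolding * by (simp only: distrib_left[of _ c] exp_add integral_mult_right_zero)
    also have "\<dots> = of_real (pi / \<kappa>) / m * exp (of_real \<kappa> * (c + (a i - p) * (b i - r) / m))"
      unfolding integral_gauss_complex[OF \<kappa> m(1)] by (simp only: distrib_left exp_add mult_ac)
    also have "c + (a i - p) * (b i - r) / m = a i * b i / m + (- (\<Sum>j\<in>S. \<Sum>k\<in>S. cnj (x j) * N $ j $ k * x k)
      + (\<Sum>j\<in>S. a' j * x j) + (\<Sum>j\<in>S. b' j * cnj (x j)))"
    proof -
      have e1: "(\<Sum>j\<in>S. a' j * x j) = (\<Sum>j\<in>S. a j * x j) - a i * r / m"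
        by (simp add: a'_def r_def sum_distrib_left sum_divide_distrib algebra_simps flip: sum_subtractf)
      have e2: "(\<Sum>j\<in>S. b' j * cnj (x j)) = (\<Sum>j\<in>S. b j * cnj (x j)) - b i * p / m"
        by (simp add: b'_def p_def sum_distrib_left sum_divide_distrib algebra_simps flip: sum_subtractf)
      show ?thesis
        unfolding QN e1 e2 p_def[symmetric] r_def[symmetric] c_def using m by (simp add: field_simps)
    qed
    finally show ?thesis by (simp only: distrib_left exp_add mult_ac)
  qed
  \<comment> \<open>Equation \<open>i\<close> of the linear system, solved for \<open>v i\<close>,
    merges the two exponents.\<close>
  have "a i * b i / m + (\<Sum>j\<in>S. a' j * v j) = (\<Sum>j\<in>insert i S. a j * v j)"
  proof -
    have e1: "m * v i + (\<Sum>k\<in>S. M $ i $ k * v k) = b i"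
      using sol[of i] insert.hyps by (simp add: m_def)
    have e2: "(\<Sum>j\<in>S. a' j * v j) = (\<Sum>j\<in>S. a j * v j) - a i / m * (\<Sum>k\<in>S. M $ i $ k * v k)"
      by (simp add: a'_def sum_distrib_left algebra_simps flip: sum_subtractf)
    show ?thesis unfolding e2 e1[symmetric] using insert.hyps m by (simp add: field_simps)
  qed
  then have ex: "exp (of_real \<kappa> * (a i * b i / m)) * exp (of_real \<kappa> * (\<Sum>j\<in>S. a' j * v j)) =
      exp (of_real \<kappa> * (\<Sum>j\<in>insert i S. a j * v j))"
    by (simp only: exp_add[symmetric] distrib_left[symmetric])
  have det: "det M = m * det N"
    unfolding m_def N_def using m by (intro det_pivot) (simp add: m_def)
  show ?case
    unfolding product_integral_insert[OF insert.hyps integrable_gauss_PiM[OF _ \<kappa> \<epsilon> coer, OF finite.insertI[OF insert.hyps(1)]]]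
      inner integral_mult_right_zero IH
    unfolding ex[symmetric] det using insert.hyps by (simp add: field_simps)
qed

section \<open>Block matrices and the bilinear product\<close>

lemma sum_UNIV_sum:
  fixes f :: "'a::finite + 'b::finite \<Rightarrow> 'c::comm_monoid_add"
  shows "sum f UNIV = (\<Sum>i\<in>UNIV. f (Inl i)) + (\<Sum>j\<in>UNIV. f (Inr j))"
  unfolding UNIV_Plus_UNIV[symmetric] by (subst sum.Plus) (simp_all add: o_def)

lemma prod_UNIV_sum:
  fixes f :: "'a::finite + 'b::finite \<Rightarrow> 'c::comm_monoid_mult"
  shows "prod f UNIV = (\<Prod>i\<in>UNIV. f (Inl i)) * (\<Prod>j\<in>UNIV. f (Inr j))"
  unfolding UNIV_Plus_UNIV[symmetric] by (subst prod.Plus) (simp_all add: o_def)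

lemma vec_upper_lower_eqI:
  "upper_vec x = upper_vec y \<Longrightarrow> lower_vec x = lower_vec y \<Longrightarrow> x = y"
  by (auto simp: upper_vec_def lower_vec_def vec_eq_iff split_sum_all)

lemma block_simps [simp]:
  "upper_vec (join_vec u v) = u" "lower_vec (join_vec u v) = v"
  "blockA (block_mat A B C D) = A" "blockB (block_mat A B C D) = B"
  "blockC (block_mat A B C D) = C" "blockD (block_mat A B C D) = D"
  by (simp_all add: upper_vec_def lower_vec_def join_vec_def blockA_def blockB_def blockC_def
      blockD_def block_mat_def vec_eq_iff)

lemma upper_lower_simps [simp]:
  fixes x y :: "complex ^ ('r::finite + 's::finite)"
  shows "upper_vec (x + y) = upper_vec x + upper_vec y" "lower_vec (x + y) = lower_vec x + lower_vec y"
    "upper_vec (x - y) = upper_vec x - upper_vec y" "lower_vec (x - y) = lower_vec x - lower_vec y"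
    "upper_vec (- x) = - upper_vec x" "lower_vec (- x) = - lower_vec x"
    "upper_vec (cnj_vec x) = cnj_vec (upper_vec x)" "lower_vec (cnj_vec x) = cnj_vec (lower_vec x)"
    "upper_vec (s_map x) = upper_vec x" "lower_vec (s_map x) = cnj_vec (lower_vec x)"
  by (simp_all add: upper_vec_def lower_vec_def vec_eq_iff cnj_vec_def s_map_def join_vec_def)

lemma upper_lower_0 [simp]: "upper_vec 0 = 0" "lower_vec 0 = 0"
  by (simp_all add: upper_vec_def lower_vec_def vec_eq_iff)

lemma block_mat_vec [simp]:
  fixes A :: "'a::comm_ring_1 ^ 'c::finite ^ 'r::finite" and D :: "'a ^ 'd::finite ^ 's::finite"
  shows "upper_vec (block_mat A B C D *v x) = A *v upper_vec x + B *v lower_vec x"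
    "lower_vec (block_mat A B C D *v x) = C *v upper_vec x + D *v lower_vec x"
  by (simp_all add: vec_eq_iff matrix_vector_mult_def block_mat_def upper_vec_def lower_vec_def
      join_vec_def sum_UNIV_sum)

lemma mat_upper_lower_simps [simp]:
  fixes x :: "complex ^ ('r::finite + 's::finite)"
  shows "block_mat (mat 1) 0 0 (mat 1) = (mat 1 :: complex ^ ('r + 's) ^ ('r + 's))"
    "block_mat (blockA k) (blockB k) (blockC k) (blockD k) = k"
  by (simp_all add: vec_eq_iff block_mat_def mat_def join_vec_def split_sum_all
      blockA_def blockB_def blockC_def blockD_def)

lemma dot_block:
  fixes x y :: "complex ^ ('r::finite + 's::finite)"
  shows "x \<bullet>\<^sub>C y = upper_vec x \<bullet>\<^sub>C upper_vec y + lower_vec x \<bullet>\<^sub>C lower_vec y"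
  by (simp add: dot_def sum_UNIV_sum upper_vec_def lower_vec_def)

lemma block_mat_mult:
  fixes A :: "'a::comm_ring_1 ^ 'c::finite ^ 'r::finite" and D :: "'a ^ 'd::finite ^ 's::finite"
    and A' :: "'a ^ 'e::finite ^ 'c" and D' :: "'a ^ 'f::finite ^ 'd"
  shows "block_mat A B C D ** block_mat A' B' C' D' =
    block_mat (A ** A' + B ** C') (A ** B' + B ** D') (C ** A' + D ** C') (C ** B' + D ** D')"
  by (simp add: vec_eq_iff matrix_matrix_mult_def block_mat_def join_vec_def split_sum_all sum_UNIV_sum)

lemma transpose_block_mat:
  "transpose (block_mat A B C D) = block_mat (transpose A) (transpose C) (transpose B) (transpose D)"
  by (simp add: vec_eq_iff transpose_def block_mat_def join_vec_def split_sum_all)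

lemma conj_transpose_block_mat:
  "conj_transpose (block_mat A B C D) =
    block_mat (conj_transpose A) (conj_transpose C) (conj_transpose B) (conj_transpose D)"
  by (simp add: vec_eq_iff conj_transpose_def cnj_mat_def map_matrix_def transpose_def block_mat_def
      join_vec_def split_sum_all)

lemma block_mat_add:
  "block_mat A B C D + block_mat A' B' C' D' = block_mat (A + A') (B + B') (C + C') (D + D')"
  by (simp add: vec_eq_iff block_mat_def join_vec_def split_sum_all)

lemma block_mat_eq_iff:
  fixes A :: "'a ^ 'c::finite ^ 'r::finite" and D :: "'a ^ 'd::finite ^ 's::finite"
  shows "block_mat A B C D = block_mat A' B' C' D' \<longleftrightarrow> A = A' \<and> B = B' \<and> C = C' \<and> D = D'"
  by (metis block_simps(3-6))

lemma dot_add_left: "(u + v) \<bullet>\<^sub>C w = u \<bullet>\<^sub>C w + v \<bullet>\<^sub>C w"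
  and dot_add_right: "w \<bullet>\<^sub>C (u + v) = w \<bullet>\<^sub>C u + w \<bullet>\<^sub>C v"
  and dot_diff_left: "(u - v) \<bullet>\<^sub>C w = u \<bullet>\<^sub>C w - v \<bullet>\<^sub>C w"
  and dot_diff_right: "w \<bullet>\<^sub>C (u - v) = w \<bullet>\<^sub>C u - w \<bullet>\<^sub>C v"
  and dot_minus_left: "(- u) \<bullet>\<^sub>C w = - (u \<bullet>\<^sub>C w)"
  and dot_minus_right: "w \<bullet>\<^sub>C (- u) = - (w \<bullet>\<^sub>C u)"
  by (simp_all add: dot_def algebra_simps sum.distrib sum_subtractf sum_negf)

lemmas dot_linear = dot_add_left dot_add_right dot_diff_left dot_diff_right dot_minus_left dot_minus_right

lemma dot_zero [simp]: "0 \<bullet>\<^sub>C u = 0" "u \<bullet>\<^sub>C 0 = 0"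
  by (simp_all add: dot_def)

lemma dot_commute: "u \<bullet>\<^sub>C v = v \<bullet>\<^sub>C u"
  by (simp add: dot_def mult.commute)

lemma dot_matrix_left: "(M *v u) \<bullet>\<^sub>C v = u \<bullet>\<^sub>C (transpose M *v v)"
proof -
  have "(M *v u) \<bullet>\<^sub>C v = (\<Sum>i\<in>UNIV. \<Sum>j\<in>UNIV. M $ i $ j * u $ j * v $ i)"
    by (simp add: dot_def matrix_vector_mult_def sum_distrib_right)
  also have "\<dots> = (\<Sum>j\<in>UNIV. \<Sum>i\<in>UNIV. M $ i $ j * u $ j * v $ i)"
    by (rule sum.swap)
  also have "\<dots> = u \<bullet>\<^sub>C (transpose M *v v)"
    by (simp add: dot_def matrix_vector_mult_def transpose_def sum_distrib_left mult_ac)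
  finally show ?thesis .
qed

lemma cnj_vec_simps [simp]:
  "cnj_vec (cnj_vec u) = u" "cnj_vec (u + v) = cnj_vec u + cnj_vec v"
  "cnj_vec (u - v) = cnj_vec u - cnj_vec v" "cnj_vec (- u) = - cnj_vec u" "cnj_vec 0 = 0"
  by (simp_all add: cnj_vec_def vec_eq_iff)

lemma cnj_vec_matrix: "cnj_vec (M *v u) = cnj_mat M *v cnj_vec u"
  by (simp add: cnj_vec_def cnj_mat_def map_matrix_def matrix_vector_mult_def vec_eq_iff)

lemma cnj_dot: "cnj (u \<bullet>\<^sub>C v) = cnj_vec u \<bullet>\<^sub>C cnj_vec v"
  by (simp add: dot_def cnj_vec_def)

lemma cnj_vec_dot_self: "cnj_vec u \<bullet>\<^sub>C u = of_real ((norm u)\<^sup>2)"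
  by (simp add: dot_def cnj_vec_def norm_vec_def L2_set_def sum_nonneg complex_norm_square[symmetric] mult.commute)

lemma cnj_vec_dot_matrix: "cnj_vec (M *v u) \<bullet>\<^sub>C v = cnj_vec u \<bullet>\<^sub>C (conj_transpose M *v v)"
  by (simp add: cnj_vec_matrix dot_matrix_left conj_transpose_def)

section \<open>Determinants of block triangular matrices\<close>

text \<open>In the Leibniz sum a row of the lower half has its only nonzero entry on the diagonal,
  so only permutations fixing all \<open>Inr\<close> indices contribute. These are the permutations
  of the upper index type, transported along \<open>Inl\<close> with unchanged sign.\<close>

lemma det_block_upper:
  fixes A :: "'a::idom ^ 'r::finite ^ 'r" and B :: "'a ^ 's::finite ^ 'r"
  shows "det (block_mat A B 0 (mat 1)) = det A"
proof -
  let ?X = "block_mat A B 0 (mat 1) :: 'a ^ ('r + 's) ^ ('r + 's)"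
  let ?I = "range (Inl :: 'r \<Rightarrow> 'r + 's)"
  let ?t = "\<lambda>p. of_int (sign p) * (\<Prod>i\<in>UNIV. ?X $ i $ p i)"
  let ?f = "map_permutation UNIV (Inl :: 'r \<Rightarrow> 'r + 's)"
  have bij: "bij_betw Inl UNIV ?I" by (simp add: bij_betw_def)
  have "det ?X = (\<Sum>p | p permutes UNIV. ?t p)" by (simp add: det_def)
  also have "\<dots> = (\<Sum>p | p permutes ?I. ?t p)"
  proof (rule sum.mono_neutral_right)
    show "{p. p permutes ?I} \<subseteq> {p. p permutes UNIV}"
      using permutes_subset by blast
    show "\<forall>p\<in>{p. p permutes UNIV} - {p. p permutes ?I}. ?t p = 0"
    proof
      fix p assume p: "p \<in> {p. p permutes UNIV} - {p. p permutes ?I}"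
      then obtain x where x: "x \<notin> ?I" "p x \<noteq> x"
        using permutes_superset[of p UNIV ?I] by auto
      then obtain b where b: "x = Inr b" by (cases x) auto
      with x have "?X $ x $ p x = 0"
        by (cases "p x") (auto simp: block_mat_def join_vec_def mat_def)
      then show "?t p = 0" by (auto intro!: prod_zero)
    qed
  qed (simp add: finite_permutations)
  also have "\<dots> = (\<Sum>p | p permutes UNIV. ?t (?f p))"
  proof (rule sum.reindex_bij_witness[of _ ?f "map_permutation ?I projl"])
    fix p :: "'r \<Rightarrow> 'r" assume "p \<in> {p. p permutes UNIV}"
    then have p: "p permutes UNIV" by simp
    show "map_permutation ?I projl (?f p) = p"
      by (rule map_permutation_compose_inv[OF bij p]) simp
    show "?f p \<in> {p. p permutes ?I}"
      using map_permutation_permutes[OF bij p] by simp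
  next
    fix p assume "p \<in> {p. p permutes ?I}"
    then have p: "p permutes ?I" by simp
    have bij': "bij_betw projl ?I UNIV"
      by (auto simp: bij_betw_def inj_on_def image_def)
    show inverse: "?f (map_permutation ?I projl p) = p"
      by (rule map_permutation_compose_inv[OF bij' p]) auto
    then show "?t (?f (map_permutation ?I projl p)) = ?t p" by (simp only:)
    show "map_permutation ?I projl p \<in> {p. p permutes UNIV}"
      using map_permutation_permutes[OF bij' p] by simp
  qed
  also have "\<dots> = det A"
    unfolding det_def
  proof (rule sum.cong[OF refl])
    fix p :: "'r \<Rightarrow> 'r" assume "p \<in> {p. p permutes UNIV}"
    then have p: "p permutes UNIV" by simp
    have "?f p (Inl i) = Inl (p i)" for i
      by (rule map_permutation_apply) auto
    moreover have "?f p (Inr j) = Inr j" for j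
      using map_permutation_permutes[OF bij p] by (auto simp: permutes_def)
    ultimately show "?t (?f p) = of_int (sign p) * (\<Prod>i\<in>UNIV. A $ i $ p i)"
      using sign_map_permutation[OF _ p, of "Inl :: 'r \<Rightarrow> 'r + 's"]
      by (simp add: prod_UNIV_sum block_mat_def join_vec_def mat_def)
  qed
  finally show ?thesis .
qed

lemma det_block_lower:
  fixes A :: "'a::idom ^ 'r::finite ^ 'r" and C :: "'a ^ 'r ^ 's::finite"
  shows "det (block_mat A 0 C (mat 1)) = det A" "det (block_mat (mat 1) 0 C (mat 1)) = 1"
proof -
  have *: "det (block_mat A 0 C (mat 1)) = det A" for A :: "'a ^ 'r ^ 'r"
  proof -
    have "transpose (block_mat A 0 C (mat 1)) = block_mat (transpose A) (transpose C) 0 (mat 1)"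
    proof -
      have "transpose (0 :: 'a ^ 's ^ 'r) = 0" by (simp add: transpose_def vec_eq_iff)
      then show ?thesis by (simp add: transpose_block_mat transpose_mat)
    qed
    then show ?thesis by (metis det_transpose det_block_upper)
  qed
  show "det (block_mat A 0 C (mat 1)) = det A" "det (block_mat (mat 1) 0 C (mat 1)) = 1"
    by (simp_all add: *)
qed

section \<open>Gaussian integrals for the normalised measure and the substitution by s\<close>

text \<open>The critical point enters as a solution \<open>v\<close> of a linear system, so it can
  later be found from \<open>k\<close> without inverting \<open>M\<close>. The normalisation of
  \<open>dm_lam\<close> cancels the power of 2 pi / lam.\<close>

lemma integral_gauss_vec:
  fixes M :: "complex ^ 'n ^ 'n"
  assumes lam: "lam > 0" and \<epsilon>: "\<epsilon> > 0"
    and coer: "\<And>u. \<epsilon> * (norm u)\<^sup>2 \<le> Re (cnj_vec u \<bullet>\<^sub>C (M *v u))"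
    and sol: "M *v v = b"
  shows "(LINT u|dm_lam lam. exp (of_real lam / 2 * (- (cnj_vec u \<bullet>\<^sub>C (M *v u)) + a \<bullet>\<^sub>C u + b \<bullet>\<^sub>C cnj_vec u)))
    = exp (of_real lam / 2 * (a \<bullet>\<^sub>C v)) / det M"
proof -
  define F where "F u = exp (of_real lam / 2 * (- (cnj_vec u \<bullet>\<^sub>C (M *v u)) + a \<bullet>\<^sub>C u + b \<bullet>\<^sub>C cnj_vec u))" for u
  let ?c = "(lam / (2 * pi)) ^ CARD('n)"
  let ?P = "PiM UNIV (\<lambda>_ :: 'n. lborel :: complex measure)"
  have form: "cnj_vec u \<bullet>\<^sub>C (M *v u) = (\<Sum>i\<in>UNIV. \<Sum>j\<in>UNIV. cnj (u $ i) * M $ i $ j * u $ j)" for u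
    by (simp add: dot_def cnj_vec_def matrix_vector_mult_def sum_distrib_left mult.assoc)
  have F: "F \<in> borel_measurable borel"
    unfolding F_def form unfolding dot_def cnj_vec_def
    by (intro borel_measurable_continuous_onI) (auto intro!: continuous_intros)
  have meas: "(\<lambda>f. \<chi> i. f i) \<in> ?P \<rightarrow>\<^sub>M (borel :: (complex ^ 'n) measure)"
    by (subst borel_measurable_euclidean_space) (auto simp: Basis_vec_def inner_axis)
  have "(LINT u|dm_lam lam. F u) = of_real ?c * (LINT u|lborel. F u)"
    unfolding dm_lam_def using lam F by (subst integral_density) (auto simp: scaleR_conv_of_real)
  also have "(LINT u|lborel. F u) = (LINT x|?P. F (\<chi> i. x i))"
    by (subst lborel_vec_eq, subst integral_distr[OF meas F]) (rule refl)
  also have "\<dots> = (LINT x|?P. exp (of_real (lam / 2) * (- (\<Sum>i\<in>UNIV. \<Sum>j\<in>UNIV. cnj (x i) * M $ i $ j * x j)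
      + (\<Sum>i\<in>UNIV. a $ i * x i) + (\<Sum>i\<in>UNIV. b $ i * cnj (x i)))))"
    unfolding F_def form by (simp add: dot_def cnj_vec_def)
  also have "\<dots> = of_real (pi / (lam / 2)) ^ CARD('n) / det M * exp (of_real (lam / 2) * (\<Sum>i\<in>UNIV. a $ i * v $ i))"
  proof (rule integral_gauss_PiM[OF finite _ \<epsilon>])
    show "\<epsilon> * (\<Sum>i\<in>UNIV. (norm (u i))\<^sup>2) \<le> Re (\<Sum>i\<in>UNIV. \<Sum>j\<in>UNIV. cnj (u i) * M $ i $ j * u j)" for u :: "'n \<Rightarrow> complex"
      using coer[of "\<chi> i. u i"] unfolding form by (simp add: norm_vec_def L2_set_def sum_nonneg)
    show "(\<Sum>j\<in>UNIV. M $ i $ j * v $ j) = b $ i" for i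
      unfolding sol[symmetric] by (simp add: matrix_vector_mult_def)
  qed (use lam in auto)
  also have "of_real ?c * (of_real (pi / (lam / 2)) ^ CARD('n) / det M * exp (of_real (lam / 2) * (\<Sum>i\<in>UNIV. a $ i * v $ i)))
      = of_real (?c * (pi / (lam / 2)) ^ CARD('n)) * (exp (of_real lam / 2 * (a \<bullet>\<^sub>C v)) / det M)"
    by (simp add: dot_def)
  also have "?c * (pi / (lam / 2)) ^ CARD('n) = 1"
    using lam unfolding power_mult_distrib[symmetric] by simp
  finally show ?thesis by (simp add: F_def)
qed

text \<open>Although not complex linear, \<open>s_map\<close> is diagonal in the real basis: it only
  flips the imaginary parts of the lower coordinates. \<open>c\<close> lists its diagonal entries,
  all of modulus 1.\<close>

lemma distr_s_map: "distr lborel borel (s_map :: complex ^ ('p::finite + 'q::finite) \<Rightarrow> _) = lborel"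
proof -
  define c where "c v = (if \<exists>j. v = axis (Inr j :: 'p + 'q) \<i> then - 1 else 1 :: real)" for v :: "complex ^ ('p + 'q)"
  have T: "(0 :: complex ^ ('p + 'q)) + (\<Sum>j\<in>Basis. (c j * (x \<bullet> j)) *\<^sub>R j) = s_map x" for x
  proof (rule euclidean_eqI)
    fix b :: "complex ^ ('p + 'q)"
    assume b: "b \<in> Basis"
    then obtain i u where iu: "b = axis i u" "u = 1 \<or> u = \<i>" by (auto simp: Basis_vec_def Basis_complex_def)
    have "(0 + (\<Sum>j\<in>Basis. (c j * (x \<bullet> j)) *\<^sub>R j)) \<bullet> b = c b * (x \<bullet> b)"
      using b by (simp add: inner_sum_left inner_Basis if_distrib sum.delta cong: if_cong)
    also have "\<dots> = s_map x \<bullet> b"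
      using iu by (cases i) (auto simp: inner_axis s_map_def join_vec_def upper_vec_def lower_vec_def
          cnj_vec_def c_def axis_eq_axis)
    finally show "(0 + (\<Sum>j\<in>Basis. (c j * (x \<bullet> j)) *\<^sub>R j)) \<bullet> b = s_map x \<bullet> b" .
  qed
  have "lborel = density (distr lborel borel (\<lambda>x. (0 :: complex ^ ('p + 'q)) + (\<Sum>j\<in>Basis. (c j * (x \<bullet> j)) *\<^sub>R j))) (\<lambda>_. (\<Prod>j\<in>Basis. \<bar>c j\<bar>))"
    by (rule lborel_affine_euclidean) (simp add: c_def)
  also have "(\<Prod>j\<in>Basis. \<bar>c j\<bar>) = 1" by (auto simp: c_def intro!: prod.neutral)
  finally show ?thesis unfolding T by (simp add: density_1)
qed

lemma integral_s_map:
  fixes F :: "complex ^ ('p::finite + 'q::finite) \<Rightarrow> complex"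
  assumes "continuous_on UNIV F" "lam > 0"
  shows "(LINT w|dm_lam lam. F (s_map w)) = (LINT u|dm_lam lam. F u)"
proof -
  have "linear (s_map :: complex ^ ('p + 'q) \<Rightarrow> _)"
    by (intro linearI) (auto simp: s_map_def join_vec_def upper_vec_def lower_vec_def cnj_vec_def
        vec_eq_iff split: sum.split)
  then have s: "(s_map :: complex ^ ('p + 'q) \<Rightarrow> _) \<in> borel \<rightarrow>\<^sub>M borel"
    by (intro borel_measurable_continuous_onI linear_continuous_on) (simp add: linear_conv_bounded_linear)
  have F: "F \<in> borel_measurable borel"
    using assms(1) by (rule borel_measurable_continuous_onI)
  have "(LINT u|lborel. F u) = (LINT w|lborel. F (s_map w))"
    by (subst distr_s_map[symmetric], subst integral_distr) (use s F in simp_all)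
  then show ?thesis
    unfolding dm_lam_def using assms(2) measurable_compose[OF s F] F by (simp add: integral_density)
qed

section \<open>Pseudo-unitary matrices\<close>

text \<open>The Hermitian form of signature (p, q), conjugate linear in the first argument. It is
  the common language in which the computed and the claimed exponents are compared.\<close>

definition herm :: "complex ^ ('p::finite + 'q::finite) \<Rightarrow> complex ^ ('p + 'q) \<Rightarrow> complex"
  where "herm x y = cnj_vec x \<bullet>\<^sub>C (J0 *v y)"

lemma matrix_minus:
  fixes X :: "'a::comm_ring_1 ^ 'n ^ 'm"
  shows "- X ** Y = - (X ** Y)" "X ** - Y = - (X ** Y)"
    "(- X) *v x = - (X *v x)" "X *v (- x) = - (X *v x)"
  by (simp_all add: matrix_matrix_mult_def matrix_vector_mult_def vec_eq_iff sum_negf)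

lemma herm_block: "herm x y =
    cnj_vec (upper_vec x) \<bullet>\<^sub>C upper_vec y - cnj_vec (lower_vec x) \<bullet>\<^sub>C lower_vec y"
proof -
  show ?thesis
    by (simp add: herm_def J0_def dot_block dot_minus_right matrix_minus)
qed

lemma herm_linear:
  "herm (x + y) z = herm x z + herm y z" "herm z (x + y) = herm z x + herm z y"
  "herm (x - y) z = herm x z - herm y z" "herm z (x - y) = herm z x - herm z y"
  by (simp_all add: herm_block dot_linear)

lemma J0_J0: "J0 ** J0 = mat 1"
  by (simp add: J0_def block_mat_mult matrix_minus)

lemma norm_block: "(norm x)\<^sup>2 = (norm (upper_vec x))\<^sup>2 + (norm (lower_vec x))\<^sup>2"
  for x :: "complex ^ ('r::finite + 's::finite)"
proof -
  have "complex_of_real ((norm x)\<^sup>2) = of_real ((norm (upper_vec x))\<^sup>2 + (norm (lower_vec x))\<^sup>2)"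
    unfolding of_real_add cnj_vec_dot_self[symmetric] by (simp add: dot_block)
  then show ?thesis by (simp only: of_real_eq_iff)
qed

lemma norm_cnj_vec [simp]: "norm (cnj_vec x) = norm x"
  by (simp add: cnj_vec_def norm_vec_def)

lemma norm_s_map [simp]: "norm (s_map x) = norm x"
proof -
  have "(norm (s_map x))\<^sup>2 = (norm x)\<^sup>2"
    unfolding norm_block by simp
  then show ?thesis by simp
qed

lemma norm_add_square: "(norm (x + y))\<^sup>2 = (norm x)\<^sup>2 + 2 * Re (cnj_vec x \<bullet>\<^sub>C y) + (norm y)\<^sup>2"
  for x y :: "complex ^ 'n"
proof -
  have "Re (cnj_vec y \<bullet>\<^sub>C x) = Re (cnj_vec x \<bullet>\<^sub>C y)"
    by (metis cnj.sel(1) cnj_dot cnj_vec_simps(1) dot_commute)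
  moreover have "(norm (x + y))\<^sup>2 = Re (cnj_vec (x + y) \<bullet>\<^sub>C (x + y))"
    "(norm x)\<^sup>2 = Re (cnj_vec x \<bullet>\<^sub>C x)" "(norm y)\<^sup>2 = Re (cnj_vec y \<bullet>\<^sub>C y)"
    by (simp_all only: cnj_vec_dot_self Re_complex_of_real)
  ultimately show ?thesis by (simp add: dot_linear)
qed

text \<open>As \<open>matrix_inv\<close> is defined by choice, a two-sided inverse has to be
  exhibited; for square matrices a trivial kernel provides it.\<close>

lemma matrix_inv_mult:
  fixes M :: "'a::field ^ 'n ^ 'n"
  assumes "\<And>x. M *v x = 0 \<Longrightarrow> x = 0"
  shows "matrix_inv M ** M = mat 1" "M ** matrix_inv M = mat 1"
proof -
  have "\<exists>N. N ** M = mat 1"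
    unfolding matrix_left_invertible_ker using assms by simp
  then obtain N where "N ** M = mat 1" ..
  then have N: "M ** N = mat 1 \<and> N ** M = mat 1"
    by (simp add: matrix_left_right_inverse[of M])
  have "M ** matrix_inv M = mat 1 \<and> matrix_inv M ** M = mat 1"
    unfolding matrix_inv_def using N by (rule someI)
  then show "matrix_inv M ** M = mat 1" "M ** matrix_inv M = mat 1" by auto
qed

lemma det_conj_transpose: "det (conj_transpose M) = cnj (det M)"
  by (simp add: conj_transpose_def det_transpose) (simp add: det_def cnj_mat_def map_matrix_def)

lemma conj_transpose_add: "conj_transpose (M + N) = conj_transpose M + conj_transpose N"
  by (simp add: conj_transpose_def cnj_mat_def map_matrix_def transpose_def vec_eq_iff)

lemma conj_transpose_mat_1 [simp]: "conj_transpose (mat 1) = mat 1"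
  by (auto simp: conj_transpose_def cnj_mat_def map_matrix_def transpose_def vec_eq_iff mat_def)

lemma cnj_mat_mult: "cnj_mat (M ** N) = cnj_mat M ** cnj_mat N"
  by (simp add: cnj_mat_def map_matrix_def matrix_matrix_mult_def vec_eq_iff)

lemma transpose_cnj_mat: "transpose (cnj_mat M) = conj_transpose M"
  by (simp add: conj_transpose_def)

section \<open>Block relations and the Potapov-Ginzburg transform\<close>

locale SU_pq_element =
  fixes k :: "complex ^ ('p::finite + 'q::finite) ^ ('p + 'q)"
  assumes k_SU: "k \<in> SU_pq"
begin

abbreviation "A \<equiv> blockA k"
abbreviation "B \<equiv> blockB k"
abbreviation "C \<equiv> blockC k"
abbreviation "D \<equiv> blockD k"

text \<open>When y = k x is solved for the upper part of x and the lower part of y, the coefficients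
  are, up to sign, \<open>Ai\<close>, \<open>P\<close>, \<open>R\<close> and the Schur complement
  \<open>T\<close>.\<close>

definition "Ai = matrix_inv A"
definition "P = Ai ** B"
definition "R = C ** Ai"
definition "T = D - R ** B"

text \<open>The group is defined by the relation with the factors in the other order; the passage
  uses that a right inverse of a square matrix is a left inverse.\<close>

lemma k_J0_k: "conj_transpose k ** J0 ** k = J0"
proof -
  have "k ** (J0 ** conj_transpose k ** J0) = mat 1"
    using k_SU J0_J0 by (simp add: SU_pq_def matrix_mul_assoc)
  then have "(J0 ** conj_transpose k ** J0) ** k = mat 1"
    by (rule matrix_left_right_inverse[THEN iffD1])
  then have "J0 ** (J0 ** conj_transpose k ** J0 ** k) = J0" by simp
  then show ?thesis by (simp add: matrix_mul_assoc J0_J0)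
qed

lemma herm_k: "herm (k *v x) (k *v y) = herm x y"
  unfolding herm_def cnj_vec_dot_matrix by (simp add: matrix_vector_mul_assoc matrix_mul_assoc k_J0_k)

lemma k_block: "upper_vec (k *v x) = A *v upper_vec x + B *v lower_vec x"
  "lower_vec (k *v x) = C *v upper_vec x + D *v lower_vec x"
  using block_mat_vec[of A B C D x] by simp_all

text \<open>If A x = 0, then \<open>k\<close> maps the positive vector (x, 0) to (0, C x), on which
  the form is not positive; so x = 0. For \<open>D\<close> the signs are exchanged.\<close>

lemma A_inv: "Ai ** A = mat 1" "A ** Ai = mat 1"
  and D_inv: "matrix_inv D ** D = mat 1" "D ** matrix_inv D = mat 1"
proof -
  have "x = 0" if "A *v x = 0" for x
  proof -
    define v :: "complex ^ ('p + 'q)" where "v = join_vec x 0"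
    have "herm (k *v v) (k *v v) = herm v v"
      by (rule herm_k)
    then have "- of_real ((norm (C *v x))\<^sup>2) = (of_real ((norm x)\<^sup>2) :: complex)"
      using that by (simp add: v_def herm_block k_block cnj_vec_dot_self)
    then have "- (norm (C *v x))\<^sup>2 = (norm x)\<^sup>2"
      by (metis of_real_eq_iff of_real_minus)
    then show "x = 0" by (smt (verit) norm_eq_zero zero_le_power2 power2_eq_square mult_eq_0_iff)
  qed
  from matrix_inv_mult[of A, OF this] show "Ai ** A = mat 1" "A ** Ai = mat 1" by (simp_all add: Ai_def)
  have "x = 0" if "D *v x = 0" for x
  proof -
    define v :: "complex ^ ('p + 'q)" where "v = join_vec 0 x"
    have "herm (k *v v) (k *v v) = herm v v"
      by (rule herm_k)
    then have "of_real ((norm (B *v x))\<^sup>2) = (- of_real ((norm x)\<^sup>2) :: complex)"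
      using that by (simp add: v_def herm_block k_block cnj_vec_dot_self)
    then have "(norm (B *v x))\<^sup>2 = - (norm x)\<^sup>2"
      by (metis of_real_eq_iff of_real_minus)
    then show "x = 0" by (smt (verit) norm_eq_zero zero_le_power2 power2_eq_square mult_eq_0_iff)
  qed
  from matrix_inv_mult[of D, OF this] show "matrix_inv D ** D = mat 1" "D ** matrix_inv D = mat 1" by simp_all
qed

text \<open>Translates the coefficients of \<open>sigma_kernel\<close>, given through the inverse of
  conjugated \<open>D\<close>, into those of the transform. Both block forms of the pseudo-unitary
  relation are needed; in particular the Schur complement \<open>T\<close> is the inverse of the
  conjugate transpose of \<open>D\<close>.\<close>

lemma sigma_blocks:
  defines "Di \<equiv> matrix_inv (cnj_mat D)"
  shows "transpose (Di ** cnj_mat C) = P" "transpose (cnj_mat B ** Di) = R" "transpose Di = T"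
proof -
  have J0_mult: "block_mat X Y Z W ** J0 = block_mat X (- Y) Z (- W)"
    "J0 ** block_mat X Y Z W = block_mat X Y (- Z) (- W)"
    for X :: "complex ^ 'p ^ 'p" and Y :: "complex ^ 'q ^ 'p" and Z :: "complex ^ 'p ^ 'q"
      and W :: "complex ^ 'q ^ 'q"
    by (simp_all add: J0_def block_mat_mult matrix_minus)
  let ?c = conj_transpose
  have kb: "k = block_mat A B C D" by simp
  have ckb: "?c k = block_mat (?c A) (?c C) (?c B) (?c D)"
    by (subst kb, subst conj_transpose_block_mat) (rule refl)
  have "block_mat (?c A) (- ?c C) (?c B) (- ?c D) ** block_mat A B C D = J0"
    using k_J0_k unfolding ckb J0_mult by simp
  then have 1: "?c B ** A + - ?c D ** C = 0" "?c B ** B + - ?c D ** D = - mat 1"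
    unfolding block_mat_mult J0_def block_mat_eq_iff by blast+
  have "block_mat A (- B) C (- D) ** block_mat (?c A) (?c C) (?c B) (?c D) = J0"
    using k_SU unfolding SU_pq_def mem_Collect_eq ckb[symmetric] by (subst J0_mult[symmetric]) simp
  then have 2: "A ** ?c C + - B ** ?c D = 0"
    unfolding block_mat_mult J0_def block_mat_eq_iff by blast
  have r: "?c B ** A = ?c D ** C" "?c D ** D = ?c B ** B + mat 1" "A ** ?c C = B ** ?c D"
    using 1 2 by (simp_all add: matrix_minus algebra_simps)
  have "cnj_mat (matrix_inv D) ** cnj_mat D = mat 1"
    using D_inv by (metis cnj_mat_mult conj_transpose_def conj_transpose_mat_1 transpose_mat transpose_transpose)
  then have Di: "Di ** cnj_mat D = mat 1"
    unfolding Di_def by (intro matrix_inv_mult) (metis matrix_left_invertible_ker)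
  define E where "E = transpose Di"
  have E: "?c D ** E = mat 1"
    using arg_cong[OF Di, of transpose] by (simp add: matrix_transpose_mul E_def transpose_cnj_mat)
  then have E': "E ** ?c D = mat 1" by (rule matrix_left_right_inverse[THEN iffD1])
  have "Ai ** (A ** ?c C) ** E = Ai ** (B ** ?c D) ** E" using r by simp
  then have "?c C ** E = P" using A_inv E
    by (simp add: P_def) (metis matrix_mul_assoc matrix_mul_lid matrix_mul_rid)
  then show "transpose (Di ** cnj_mat C) = P"
    by (simp add: matrix_transpose_mul E_def transpose_cnj_mat)
  have "E ** (?c D ** C) ** Ai = E ** (?c B ** A) ** Ai" using r by simp
  then have ER: "E ** ?c B = R" using A_inv E'
    by (simp add: R_def) (metis matrix_mul_assoc matrix_mul_lid matrix_mul_rid)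
  then show "transpose (cnj_mat B ** Di) = R"
    by (simp add: matrix_transpose_mul E_def transpose_cnj_mat)
  have "E ** (?c D ** D) = E ** ?c B ** B + E"
    unfolding r by (simp add: matrix_add_ldistrib matrix_mul_assoc)
  then have "D = R ** B + E"
    using E' by (simp add: matrix_mul_assoc ER)
  then show "transpose Di = T" unfolding T_def by (simp add: E_def algebra_simps)
qed

text \<open>
  Up to signs, \<open>V\<close> is the Potapov-Ginzburg transform of \<open>k\<close>: solving \<open>y = k *v x\<close> for
  the upper part of \<open>x\<close> and the lower part of \<open>y\<close> turns an isometry of the indefinite form
  \<open>herm\<close> into a unitary matrix.
\<close>

definition "V = block_mat Ai P (- R) T"

lemma PG:
  assumes "k *v x = y"
  shows "upper_vec x = Ai *v upper_vec y - P *v lower_vec x" "lower_vec y = R *v upper_vec y + T *v lower_vec x"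
proof -
  have y: "upper_vec y = A *v upper_vec x + B *v lower_vec x" "lower_vec y = C *v upper_vec x + D *v lower_vec x"
    using assms k_block by auto
  show x: "upper_vec x = Ai *v upper_vec y - P *v lower_vec x"
    unfolding y by (simp add: P_def matrix_vector_right_distrib matrix_vector_mul_assoc matrix_mul_assoc A_inv)
  have "R *v upper_vec y = C *v upper_vec x + (R ** B) *v lower_vec x"
    unfolding y R_def by (simp add: matrix_vector_right_distrib matrix_vector_mul_assoc matrix_mul_assoc[symmetric] A_inv)
  then show "lower_vec y = R *v upper_vec y + T *v lower_vec x"
    unfolding y(2) T_def by (simp add: matrix_vector_mult_diff_rdistrib)
qed

lemma norm_V: "norm (V *v u) = norm u"
proof -
  \<comment> \<open>The minus sign in the lower half accounts for the signs of \<open>P\<close> and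
    \<open>R\<close> in \<open>V\<close>: then \<open>k\<close> maps \<open>x\<close> to (upper part
    of u, w), while V u = (upper part of x, - w).\<close>
  define x where "x = join_vec (Ai *v upper_vec u + P *v lower_vec u) (- lower_vec u)"
  define w where "w = R *v upper_vec u - T *v lower_vec u"
  have "k *v x = join_vec (upper_vec u) (R *v upper_vec u - T *v lower_vec u)"
  proof (rule vec_upper_lower_eqI)
    have "A ** P = B"
      by (simp add: P_def matrix_mul_assoc A_inv)
    then show "upper_vec (k *v x) = upper_vec (join_vec (upper_vec u) (R *v upper_vec u - T *v lower_vec u))"
      by (simp add: k_block x_def matrix_minus matrix_vector_right_distrib matrix_vector_mul_assoc A_inv)
    have "C ** P = R ** B" by (simp add: P_def R_def matrix_mul_assoc)
    then show "lower_vec (k *v x) = lower_vec (join_vec (upper_vec u) (R *v upper_vec u - T *v lower_vec u))"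
      by (simp add: k_block x_def matrix_minus matrix_vector_right_distrib matrix_vector_mul_assoc R_def[symmetric]
          T_def matrix_vector_mult_diff_rdistrib)
  qed
  then have "herm (join_vec (upper_vec u) w) (join_vec (upper_vec u) w) = herm x x"
    using herm_k[of x x] by (simp only: w_def)
  then have "cnj_vec (upper_vec u) \<bullet>\<^sub>C upper_vec u - cnj_vec w \<bullet>\<^sub>C w =
      cnj_vec (upper_vec x) \<bullet>\<^sub>C upper_vec x - cnj_vec (lower_vec u) \<bullet>\<^sub>C lower_vec u"
    unfolding herm_block by (simp add: x_def dot_minus_left dot_minus_right del: cnj_vec_simps(2,3))
  \<comment> \<open>Moving the negative terms across the equality of indefinite forms leaves an
    equality of norms.\<close>
  moreover have "a - c = b - d \<Longrightarrow> a + d = b + c" for a b c d :: complex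
    by algebra
  ultimately have "cnj_vec (upper_vec u) \<bullet>\<^sub>C upper_vec u + cnj_vec (lower_vec u) \<bullet>\<^sub>C lower_vec u =
      cnj_vec (upper_vec x) \<bullet>\<^sub>C upper_vec x + cnj_vec w \<bullet>\<^sub>C w"
    by blast
  also have "\<dots> = cnj_vec (V *v u) \<bullet>\<^sub>C (V *v u)"
  proof -
    have "upper_vec (V *v u) = upper_vec x" "lower_vec (V *v u) = - w"
      by (simp_all add: V_def x_def w_def matrix_minus)
    then show ?thesis
      unfolding dot_block[of "cnj_vec (V *v u)"] upper_lower_simps by (simp add: dot_minus_left dot_minus_right)
  qed
  finally have "cnj_vec (V *v u) \<bullet>\<^sub>C (V *v u) = cnj_vec u \<bullet>\<^sub>C u"
    by (simp add: dot_block[of _ u])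
  then show ?thesis unfolding cnj_vec_dot_self of_real_eq_iff by (simp add: power2_eq_iff_nonneg)
qed

end

section \<open>Kernels and the Weyl symbol\<close>

lemma dot_vector_matrix [simp]:
  "(u v* M) \<bullet>\<^sub>C v = u \<bullet>\<^sub>C (M *v v)" "v \<bullet>\<^sub>C (u v* M) = u \<bullet>\<^sub>C (M *v v)"
proof -
  show "(u v* M) \<bullet>\<^sub>C v = u \<bullet>\<^sub>C (M *v v)"
    using dot_matrix_left[of "transpose M" u v] by simp
  then show "v \<bullet>\<^sub>C (u v* M) = u \<bullet>\<^sub>C (M *v v)"
    by (metis dot_commute)
qed

text \<open>The identity f(z) = <f, e_z> for the only type of function that is needed. The bound on
  \<open>R\<close> leaves half of the Gaussian weight, which secures convergence.\<close>

lemma fock_reproducing: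
  fixes R :: "complex ^ 'p::finite ^ 'q::finite" and l z :: "complex ^ ('p + 'q)"
  assumes lam: "lam > 0" and R: "\<And>x y. 2 * Re (x \<bullet>\<^sub>C (R *v y)) \<le> (norm x)\<^sup>2 + (norm y)\<^sup>2"
  shows "(LINT x|dm_lam lam. exp (of_real lam / 2 * (lower_vec x \<bullet>\<^sub>C (R *v upper_vec x) + l \<bullet>\<^sub>C x)) *
      cnj (coherent lam z x) * of_real (exp (- lam * (norm x)\<^sup>2 / 2))) =
    exp (of_real lam / 2 * (lower_vec z \<bullet>\<^sub>C (R *v upper_vec z) + l \<bullet>\<^sub>C z))"
proof -
  \<comment> \<open>After the substitution by \<open>s_map\<close> the quadratic term becomes an
    off-diagonal block, so the matrix is unipotent and no determinant appears. The lower halves of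
    the two linear coefficients change places.\<close>
  define M where "M = block_mat (mat 1) 0 (- R) (mat 1)"
  define a where "a = join_vec (upper_vec l) (lower_vec z)"
  define b where "b = join_vec (upper_vec z) (lower_vec l)"
  define v where "v = join_vec (upper_vec z) (lower_vec l + R *v upper_vec z)"
  define F where "F u = exp (of_real lam / 2 * (- (cnj_vec u \<bullet>\<^sub>C (M *v u)) + a \<bullet>\<^sub>C u + b \<bullet>\<^sub>C cnj_vec u))" for u
  have form: "cnj_vec u \<bullet>\<^sub>C (M *v u) = of_real ((norm u)\<^sup>2) - cnj_vec (lower_vec u) \<bullet>\<^sub>C (R *v upper_vec u)" for u
    unfolding cnj_vec_dot_self[symmetric] M_def by (simp add: dot_block matrix_minus dot_linear)
  have "exp (of_real lam / 2 * (lower_vec x \<bullet>\<^sub>C (R *v upper_vec x) + l \<bullet>\<^sub>C x)) *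
      cnj (coherent lam z x) * of_real (exp (- lam * (norm x)\<^sup>2 / 2)) = F (s_map x)" for x
  proof -
    have "cnj (coherent lam z x) = exp (of_real lam / 2 * (z \<bullet>\<^sub>C cnj_vec x))"
      by (simp add: coherent_def exp_cnj cnj_dot)
    moreover have "complex_of_real (exp (- lam * (norm x)\<^sup>2 / 2)) = exp (of_real lam / 2 * (- of_real ((norm x)\<^sup>2)))"
      by (simp add: exp_of_real[symmetric])
    ultimately show ?thesis
      unfolding F_def form norm_s_map
      by (simp only: exp_add[symmetric] distrib_left[symmetric])
        (simp add: dot_block a_def b_def dot_commute algebra_simps)
  qed
  then have "(LINT x|dm_lam lam. exp (of_real lam / 2 * (lower_vec x \<bullet>\<^sub>C (R *v upper_vec x) + l \<bullet>\<^sub>C x)) *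
      cnj (coherent lam z x) * of_real (exp (- lam * (norm x)\<^sup>2 / 2))) = (LINT x|dm_lam lam. F (s_map x))"
    by simp
  also have "\<dots> = (LINT u|dm_lam lam. F u)"
  proof (rule integral_s_map[OF _ lam])
    show "continuous_on UNIV F"
      unfolding F_def dot_def cnj_vec_def matrix_vector_mult_def by (auto intro!: continuous_intros)
  qed
  also have "\<dots> = exp (of_real lam / 2 * (a \<bullet>\<^sub>C v)) / det M"
    unfolding F_def
  proof (rule integral_gauss_vec[OF lam, of "1 / 2"])
    show "1 / 2 * (norm u)\<^sup>2 \<le> Re (cnj_vec u \<bullet>\<^sub>C (M *v u))" for u
      using R[of "cnj_vec (lower_vec u)" "upper_vec u"] norm_block[of u] unfolding form by simp
    show "M *v v = b"
      by (rule vec_upper_lower_eqI) (simp_all add: M_def v_def b_def matrix_minus)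
  qed simp
  also have "det M = 1" unfolding M_def by (rule det_block_lower)
  finally show ?thesis
    by (simp add: a_def v_def dot_block dot_linear dot_commute algebra_simps)
qed

section \<open>Kernels of sigma and of pi\<close>

context SU_pq_element
begin

text \<open>The exponent of the kernel of \<open>sigma\<close> as a polynomial without conjugations;
  \<open>y\<close> stands for the conjugate of the second kernel variable.\<close>

definition q :: "complex ^ ('p + 'q) \<Rightarrow> complex ^ ('p + 'q) \<Rightarrow> complex"
  where "q z y = lower_vec z \<bullet>\<^sub>C (T *v lower_vec y) + upper_vec y \<bullet>\<^sub>C (Ai *v upper_vec z)
    + lower_vec z \<bullet>\<^sub>C (R *v upper_vec z) - upper_vec y \<bullet>\<^sub>C (P *v lower_vec y)"

lemma sigma_kernel_eq:
  "sigma_kernel lam k z w = inverse (det A) * exp (of_real lam / 2 * q z (cnj_vec w))"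
proof -
  have "(matrix_inv (cnj_mat D) ** cnj_mat C *v cnj_vec (upper_vec w)) \<bullet>\<^sub>C cnj_vec (lower_vec w)
      = cnj_vec (upper_vec w) \<bullet>\<^sub>C (P *v cnj_vec (lower_vec w))"
    "(matrix_inv (cnj_mat D) *v lower_vec z) \<bullet>\<^sub>C cnj_vec (lower_vec w) = lower_vec z \<bullet>\<^sub>C (T *v cnj_vec (lower_vec w))"
    "upper_vec z \<bullet>\<^sub>C (cnj_mat B ** matrix_inv (cnj_mat D) *v lower_vec z) = lower_vec z \<bullet>\<^sub>C (R *v upper_vec z)"
    by (simp_all add: dot_matrix_left sigma_blocks dot_commute[of "upper_vec z"])
  then show ?thesis
    by (simp add: sigma_kernel_def Let_def q_def Ai_def[symmetric] dot_commute[of "cnj_vec (upper_vec w)" "Ai *v _"] algebra_simps)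
qed

text \<open>Up to sign, \<open>R\<close> and \<open>P\<close> are blocks of the unitary
  \<open>V\<close>, hence contractions; Young's inequality does the rest.\<close>

lemma contraction:
  "2 * Re (x \<bullet>\<^sub>C (R *v y)) \<le> (norm x)\<^sup>2 + (norm y)\<^sup>2"
  "- 2 * Re (x' \<bullet>\<^sub>C (P *v y')) \<le> (norm x')\<^sup>2 + (norm y')\<^sup>2"
proof -
  have young: "2 * Re (x \<bullet>\<^sub>C w) \<le> (norm x)\<^sup>2 + (norm w)\<^sup>2" "- 2 * Re (x \<bullet>\<^sub>C w) \<le> (norm x)\<^sup>2 + (norm w)\<^sup>2"
    for x w :: "complex ^ 'n"
  proof -
    have "0 \<le> (norm (cnj_vec x + w))\<^sup>2" "0 \<le> (norm (cnj_vec x + (- w)))\<^sup>2" by simp_all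
    then show "2 * Re (x \<bullet>\<^sub>C w) \<le> (norm x)\<^sup>2 + (norm w)\<^sup>2" "- 2 * Re (x \<bullet>\<^sub>C w) \<le> (norm x)\<^sup>2 + (norm w)\<^sup>2"
      unfolding norm_add_square by (simp_all add: dot_minus_right)
  qed
  have "(norm (R *v y))\<^sup>2 \<le> (norm y)\<^sup>2"
  proof -
    have "(norm (V *v join_vec y 0))\<^sup>2 = (norm (join_vec y 0 :: complex ^ ('p + 'q)))\<^sup>2" by (simp add: norm_V)
    then have "(norm (Ai *v y))\<^sup>2 + (norm (R *v y))\<^sup>2 = (norm y)\<^sup>2"
      by (simp add: norm_block V_def matrix_minus)
    then show ?thesis using zero_le_power2[of "norm (Ai *v y)"] by linarith
  qed
  with young(1)[of x "R *v y"] show "2 * Re (x \<bullet>\<^sub>C (R *v y)) \<le> (norm x)\<^sup>2 + (norm y)\<^sup>2" by linarith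
  have "(norm (P *v y'))\<^sup>2 \<le> (norm y')\<^sup>2"
  proof -
    have "(norm (V *v join_vec 0 y'))\<^sup>2 = (norm (join_vec 0 y' :: complex ^ ('p + 'q)))\<^sup>2" by (simp add: norm_V)
    then have "(norm (P *v y'))\<^sup>2 + (norm (T *v y'))\<^sup>2 = (norm y')\<^sup>2"
      by (simp add: norm_block V_def matrix_minus)
    then show ?thesis using zero_le_power2[of "norm (T *v y')"] by linarith
  qed
  with young(2)[of x' "P *v y'"] show "- 2 * Re (x' \<bullet>\<^sub>C (P *v y')) \<le> (norm x')\<^sup>2 + (norm y')\<^sup>2" by linarith
qed

text \<open>As a function of its second variable the kernel is a constant times the conjugate of a
  function \<open>F\<close> covered by \<open>fock_reproducing\<close>; integrating against a
  coherent state therefore evaluates \<open>F\<close>.\<close>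

lemma sigma_coherent:
  assumes lam: "lam > 0"
  shows "sigma lam k (coherent lam w) z = sigma_kernel lam k z w"
proof -
  let ?P = "- conj_transpose P"
  define l where "l = cnj_vec (join_vec (Ai *v upper_vec z) (transpose T *v lower_vec z))"
  define c where "c = inverse (det A) * exp (of_real lam / 2 * (lower_vec z \<bullet>\<^sub>C (R *v upper_vec z)))"
  define F where "F x = exp (of_real lam / 2 * (lower_vec x \<bullet>\<^sub>C (?P *v upper_vec x) + l \<bullet>\<^sub>C x))" for x
  have conjP: "x \<bullet>\<^sub>C (?P *v y) = - cnj (cnj_vec y \<bullet>\<^sub>C (P *v cnj_vec x))" for x y
    by (simp only: matrix_minus dot_minus_right conj_transpose_def dot_matrix_left[symmetric] cnj_dot
        cnj_vec_matrix cnj_vec_simps(1)) (simp only: dot_commute)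
  have kernel: "sigma_kernel lam k z x = c * cnj (F x)" for x
  proof -
    have "cnj (F x) = exp (of_real lam / 2 * (- (cnj_vec (upper_vec x) \<bullet>\<^sub>C (P *v cnj_vec (lower_vec x))) + cnj_vec l \<bullet>\<^sub>C cnj_vec x))"
      unfolding F_def conjP by (simp add: exp_cnj cnj_dot)
    moreover have "cnj_vec l \<bullet>\<^sub>C cnj_vec x = lower_vec z \<bullet>\<^sub>C (T *v cnj_vec (lower_vec x)) + cnj_vec (upper_vec x) \<bullet>\<^sub>C (Ai *v upper_vec z)"
      unfolding l_def by (simp add: dot_block dot_commute[of "Ai *v _"])
    ultimately show ?thesis
      unfolding sigma_kernel_eq c_def q_def
      by (simp add: exp_add[symmetric] algebra_simps)
  qed
  have "sigma lam k (coherent lam w) z =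
      (LINT x|dm_lam lam. c * cnj (F x * cnj (coherent lam w x) * of_real (exp (- lam * (norm x)\<^sup>2 / 2))))"
    unfolding sigma_def kernel by (simp add: mult.assoc)
  also have "\<dots> = c * cnj (LINT x|dm_lam lam. F x * cnj (coherent lam w x) * of_real (exp (- lam * (norm x)\<^sup>2 / 2)))"
    by (simp only: integral_mult_right_zero Bochner_Integration.integral_cnj)
  also have "\<dots> = c * cnj (F w)"
    unfolding F_def
  proof (subst fock_reproducing[OF lam])
    show "2 * Re (x \<bullet>\<^sub>C (?P *v y)) \<le> (norm x)\<^sup>2 + (norm y)\<^sup>2" for x y
      using contraction(2)[of "cnj_vec y" "cnj_vec x"] unfolding conjP by simp
  qed (rule refl)
  finally show ?thesis by (simp add: kernel)
qed

text \<open>\<open>rho\<close> shifts the argument and multiplies by the exponential of an affine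
  function, so the quadratic part with \<open>R\<close> is unchanged and the reproducing integral
  applies once more.\<close>

lemma op_kernel_pi:
  assumes lam: "lam > 0"
  shows "op_kernel lam (pi_rep lam ((z0, cnj_vec z0), c0, k)) z w =
    exp (\<i> * of_real lam * of_real c0) * inverse (det A) *
    exp (of_real lam / 2 * (cnj_vec (s_map z0) \<bullet>\<^sub>C z - of_real ((norm z0)\<^sup>2) / 2 + q (z - s_map z0) (cnj_vec w)))"
proof -
  let ?s = "s_map z0" and ?y = "cnj_vec w"
  \<comment> \<open>\<open>l\<close> and \<open>d\<close> are the linear and constant parts in x of
    the exponent shifted by \<open>?s\<close>.\<close>
  define l where "l = cnj_vec ?s + join_vec (transpose Ai *v upper_vec ?y - transpose R *v lower_vec ?s)
    (T *v lower_vec ?y - R *v upper_vec ?s)"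
  define d where "d = - of_real ((norm z0)\<^sup>2) / 2 + q (- ?s) ?y"
  define c where "c = exp (\<i> * of_real lam * of_real c0) * inverse (det A) * exp (of_real lam / 2 * d)"
  define F where "F x = exp (of_real lam / 2 * (lower_vec x \<bullet>\<^sub>C (R *v upper_vec x) + l \<bullet>\<^sub>C x))" for x
  have eq: "cnj_vec ?s \<bullet>\<^sub>C x - of_real ((norm z0)\<^sup>2) / 2 + q (x - ?s) ?y = d + (lower_vec x \<bullet>\<^sub>C (R *v upper_vec x) + l \<bullet>\<^sub>C x)" for x
    unfolding d_def q_def l_def
    by (simp add: dot_block dot_linear matrix_minus matrix_vector_mult_diff_distrib
        dot_commute[of "T *v _"] dot_commute[of "R *v _"] algebra_simps)
  have kernel: "pi_rep lam ((z0, cnj_vec z0), c0, k) (coherent lam w) x = c * F x" for x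
  proof -
    have "exp (of_real lam * (cnj_vec (s_map z0) \<bullet>\<^sub>C x / 2 - of_real ((norm z0)\<^sup>2) / 4)) *
        exp (of_real lam / 2 * q (x - ?s) ?y) = exp (of_real lam / 2 * (d + (lower_vec x \<bullet>\<^sub>C (R *v upper_vec x) + l \<bullet>\<^sub>C x)))"
      unfolding eq[symmetric] exp_add[symmetric] by (simp add: algebra_simps)
    also have "\<dots> = exp (of_real lam / 2 * d) * F x"
      unfolding F_def exp_add[symmetric] by (simp add: algebra_simps)
    finally show ?thesis
      unfolding pi_rep_def rho_def c_def
      by (simp add: sigma_coherent[OF lam] sigma_kernel_eq mult_ac)
  qed
  have "op_kernel lam (pi_rep lam ((z0, cnj_vec z0), c0, k)) z w =
      c * (LINT x|dm_lam lam. F x * cnj (coherent lam z x) * of_real (exp (- lam * (norm x)\<^sup>2 / 2)))"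
    unfolding op_kernel_def fock_inner_def kernel by (simp add: mult.assoc)
  also have "\<dots> = c * F z"
    unfolding F_def by (subst fock_reproducing[OF lam contraction(1)]) (rule refl)
  also have "\<dots> = exp (\<i> * of_real lam * of_real c0) * inverse (det A) *
    exp (of_real lam / 2 * (d + (lower_vec z \<bullet>\<^sub>C (R *v upper_vec z) + l \<bullet>\<^sub>C z)))"
    unfolding c_def F_def by (simp add: distrib_left exp_add)
  finally show ?thesis unfolding eq .
qed

end

section \<open>The doubled space and tilde k\<close>

definition real_form :: "complex ^ 'n::finite \<Rightarrow> complex ^ ('n + 'n)"
  where "real_form v = join_vec v (cnj_vec v)"

lemma real_form_linear:
  "real_form (u + v) = real_form u + real_form v" "real_form (u - v) = real_form u - real_form v"
  by (rule vec_upper_lower_eqI; simp add: real_form_def)+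

lemma s_map_linear: "s_map (u + v) = s_map u + s_map v" "s_map (u - v) = s_map u - s_map v"
  by (rule vec_upper_lower_eqI; simp)+

lemma s_map_s_map [simp]: "s_map (s_map v) = v"
  by (rule vec_upper_lower_eqI; simp)

lemma cnj_mat_cnj_mat [simp]: "cnj_mat (cnj_mat M) = M"
  by (simp add: cnj_mat_def map_matrix_def vec_eq_iff)

lemma matrix_add_rdistrib: "(A + B) ** C = A ** C + B ** C"
  by (simp add: matrix_matrix_mult_def vec_eq_iff distrib_right sum.distrib)

text \<open>On vectors (v, conjugate of v) the symplectic matrix computes the antisymmetric part of
  \<open>herm\<close>; through this identity the three exponents of the theorem become expressions
  in \<open>herm\<close>.\<close>

lemma Jmat_real_form:
  "real_form (s_map x) \<bullet>\<^sub>C (Jmat *v real_form (s_map y)) = herm y x - herm x y"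
  by (simp add: real_form_def Jmat_def matrix_minus dot_block herm_block dot_linear dot_commute)

lemma linear_matrix_vector_mult: "linear ((*v) M)" for M :: "complex ^ 'n ^ 'm"
proof (rule linearI)
  show "M *v (r *\<^sub>R x) = r *\<^sub>R (M *v x)" for r x
    by (simp add: matrix_vector_mult_def vec_eq_iff scaleR_sum_right)
qed (rule matrix_vector_right_distrib)

context SU_pq_element
begin

text \<open>This explains the shape of \<open>tilde_mat\<close>: it is the real linear map s k s,
  written on pairs (v, conjugate of v).\<close>

lemma tilde_real_form: "tilde_mat k *v real_form (s_map x) = real_form (s_map (k *v x))"
  by (rule vec_upper_lower_eqI; rule vec_upper_lower_eqI)
    (simp_all add: tilde_mat_def real_form_def k_block cnj_vec_matrix add.commute)

text \<open>Pseudo-unitarity exchanges \<open>k + mat 1\<close> with its conjugate transpose up to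
  factors \<open>J0\<close> and the conjugate transpose of \<open>k\<close>; since det k = 1, the
  determinant equals its conjugate.\<close>

lemma det_k_real: "Im (det (k + mat 1)) = 0"
proof -
  have "(conj_transpose k ** J0) ** (k + mat 1) = conj_transpose (k + mat 1) ** J0"
    by (simp add: matrix_add_ldistrib k_J0_k conj_transpose_add matrix_add_rdistrib add.commute)
  from arg_cong[OF this, of det] have "cnj (det k) * det (J0 :: complex ^ ('p + 'q) ^ ('p + 'q)) * det (k + mat 1) =
      cnj (det (k + mat 1)) * det (J0 :: complex ^ ('p + 'q) ^ ('p + 'q))"
    by (simp only: det_mul det_conj_transpose)
  moreover have "det k = 1" using k_SU by (simp add: SU_pq_def)
  moreover have "det (J0 :: complex ^ ('p + 'q) ^ ('p + 'q)) \<noteq> 0"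
  proof -
    have "det (J0 ** J0 :: complex ^ ('p + 'q) ^ ('p + 'q)) = 1" by (simp add: J0_J0)
    then show ?thesis by (auto simp: det_mul)
  qed
  ultimately have "det (k + mat 1) = cnj (det (k + mat 1))" by simp
  from arg_cong[OF this, of Im] show ?thesis by simp
qed

end

locale SU_pq_regular = SU_pq_element k
  for k :: "complex ^ ('p::finite + 'q::finite) ^ ('p + 'q)" +
  assumes regular: "invertible (k + mat 1)"
begin

lemma kernel_trivial: "k *v x = - x \<Longrightarrow> x = 0"
proof -
  assume "k *v x = - x"
  then have "(k + mat 1) *v x = 0" by (simp add: matrix_vector_mult_add_rdistrib)
  moreover obtain N where "N ** (k + mat 1) = mat 1" using regular by (auto simp: invertible_def)
  ultimately show "x = 0" using matrix_vector_mul_assoc[of N "k + mat 1" x] by simp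
qed

lemma solve: obtains y where "k *v y + y = x"
proof -
  obtain N where "(k + mat 1) ** N = mat 1" using regular by (auto simp: invertible_def)
  then have "(k + mat 1) *v (N *v x) = x" by (simp add: matrix_vector_mul_assoc)
  then show thesis by (intro that[of "N *v x"]) (simp add: matrix_vector_mult_add_rdistrib)
qed

text \<open>Replaces the inverse in dimension 2n by an equation for \<open>k\<close> on C^n. The
  vectors of real form are not a complex subspace, so invertibility on the whole space is checked
  separately.\<close>

lemma tilde_inv:
  assumes "k *v y + y = x"
  shows "matrix_inv (tilde_mat k + mat 1) *v real_form (s_map x) = real_form (s_map y)"
proof -
  let ?K = "tilde_mat k + mat 1"
  have "v = 0" if "?K *v v = 0" for v
  proof -
    \<comment> \<open>After regrouping blocks, \<open>tilde_mat k\<close> is the direct sum of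
      \<open>k\<close>, acting on blocks one and four, and the conjugate of \<open>k\<close>, acting
      on blocks three and two.\<close>
    define x where "x = join_vec (upper_vec (upper_vec v)) (lower_vec (lower_vec v))"
    define x' where "x' = join_vec (upper_vec (lower_vec v)) (lower_vec (upper_vec v))"
    have v: "tilde_mat k *v v = - v"
      using that by (simp add: matrix_vector_mult_add_rdistrib eq_neg_iff_add_eq_0)
    have "k *v x = - x"
      using arg_cong[OF v, of "\<lambda>v. upper_vec (upper_vec v)"] arg_cong[OF v, of "\<lambda>v. lower_vec (lower_vec v)"]
      by (intro vec_upper_lower_eqI) (simp_all add: tilde_mat_def k_block x_def add.commute)
    moreover have "cnj_vec (k *v cnj_vec x') = - x'"
      using arg_cong[OF v, of "\<lambda>v. lower_vec (upper_vec v)"] arg_cong[OF v, of "\<lambda>v. upper_vec (lower_vec v)"]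
      by (intro vec_upper_lower_eqI; unfold upper_lower_simps k_block)
        (simp_all add: tilde_mat_def x'_def add.commute cnj_vec_matrix)
    then have "k *v cnj_vec x' = - cnj_vec x'"
      by (metis cnj_vec_simps(1,4))
    ultimately have "x = 0" "cnj_vec x' = 0"
      using kernel_trivial by blast+
    then have "x = 0" "x' = 0"
      by (simp, metis cnj_vec_simps(1,5))
    from this[THEN arg_cong, of upper_vec] this[THEN arg_cong, of lower_vec]
    have "upper_vec (upper_vec v) = 0" "lower_vec (lower_vec v) = 0"
      "upper_vec (lower_vec v) = 0" "lower_vec (upper_vec v) = 0"
      by (simp_all add: x_def x'_def)
    then show "v = 0"
      by (intro vec_upper_lower_eqI) simp_all
  qed
  note inv = matrix_inv_mult[of ?K, OF this]
  have "?K *v real_form (s_map y) = real_form (s_map x)"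
    unfolding assms[symmetric]
    by (simp add: matrix_vector_mult_add_rdistrib tilde_real_form real_form_linear s_map_linear)
  from arg_cong[OF this, of "(*v) (matrix_inv ?K)"] show ?thesis
    by (simp add: matrix_vector_mul_assoc inv(1))
qed

lemma det_M: "det A * det (mat 1 + V) = det (k + mat 1)"
proof -
  \<comment> \<open>In the lower row, C Ai = R cancels the block - R of \<open>V\<close>, and C P =
    R B completes \<open>T\<close> to \<open>D\<close>.\<close>
  have "block_mat A 0 C (mat 1) ** (mat 1 + V) = k + mat 1"
  proof -
    have P: "A ** P = B" "C ** P = R ** B" by (simp_all add: P_def R_def matrix_mul_assoc A_inv)
    have "mat 1 + V = block_mat (mat 1 + Ai) P (- R) (mat 1 + T)"
      unfolding V_def mat_upper_lower_simps(1)[symmetric] block_mat_add by simp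
    moreover have "k + mat 1 = block_mat (A + mat 1) B C (D + mat 1)"
      using block_mat_add[of A B C D "mat 1" 0 0 "mat 1"] by simp
    ultimately show ?thesis
      by (simp add: block_mat_mult matrix_add_ldistrib A_inv matrix_minus P R_def[symmetric] T_def add.commute)
  qed
  then show ?thesis by (metis det_mul det_block_lower(1))
qed

text \<open>Since \<open>V\<close> is unitary, the real part of the form of \<open>mat 1 + V\<close> at \<open>u\<close> is half the square of the
  norm of \<open>(mat 1 + V) *v u\<close>.\<close>

lemma coercive_M:
  obtains \<epsilon> where "\<epsilon> > 0" "\<And>u. \<epsilon> * (norm u)\<^sup>2 \<le> Re (cnj_vec u \<bullet>\<^sub>C ((mat 1 + V) *v u))"
proof -
  let ?M = "mat 1 + V"
  have "det (k + mat 1) \<noteq> 0" using regular by (simp add: invertible_det_nz)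
  then have "det ?M \<noteq> 0" using det_M by auto
  then obtain N where N: "N ** ?M = mat 1" using invertible_det_nz[of ?M] by (auto simp: invertible_def)
  obtain K where K: "K > 0" "\<And>w. norm (N *v w) \<le> K * norm w"
    using linear_bounded_pos[OF linear_matrix_vector_mult] by metis
  have "1 / (2 * K\<^sup>2) * (norm u)\<^sup>2 \<le> Re (cnj_vec u \<bullet>\<^sub>C (?M *v u))" for u
  proof -
    have "norm u = norm (N *v (?M *v u))" by (simp add: matrix_vector_mul_assoc N)
    also have "\<dots> \<le> K * norm (?M *v u)" by (rule K)
    finally have "(norm u)\<^sup>2 \<le> K\<^sup>2 * (norm (?M *v u))\<^sup>2"
      unfolding power_mult_distrib[symmetric] by (intro power_mono) auto
    also have "(norm (?M *v u))\<^sup>2 = 2 * Re (cnj_vec u \<bullet>\<^sub>C (?M *v u))"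
      by (simp add: matrix_vector_mult_add_rdistrib norm_add_square norm_V dot_linear cnj_vec_dot_self)
    finally show ?thesis using K(1) by (simp add: field_simps)
  qed
  then show thesis using K(1) by (intro that[of "1 / (2 * K\<^sup>2)"]) auto
qed

section \<open>The Weyl symbol and its critical value\<close>

text \<open>The hypothesis on \<open>u\<close> says that the affine map v -> k v + z0 sends s(z) - u
  to s(z) + u, so that s(z) is the midpoint. This is the critical point equation of the Gaussian
  integral.\<close>

lemma weyl_pi:
  assumes lam: "lam > 0" and u: "k *v u + u = k *v s_map z - s_map z + z0"
  shows "weyl_symbol lam (pi_rep lam ((z0, cnj_vec z0), c0, k)) z =
    2 ^ CARD('p + 'q) * exp (\<i> * of_real lam * of_real c0) * inverse (det (k + mat 1)) *
    exp (of_real lam / 2 * (herm z0 (s_map z + u) - 2 * herm (s_map z) u - herm z0 z0 / 2))"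
proof -
  let ?M = "mat 1 + V"
  let ?z1 = "upper_vec z" and ?z2 = "lower_vec z" and ?c1 = "upper_vec z0" and ?c2 = "lower_vec z0"
  \<comment> \<open>\<open>a\<close>, \<open>b\<close> and \<open>c\<close> are the linear and
    constant coefficients, in the variable s(w), of the integrand of the Weyl symbol.\<close>
  define a where "a = join_vec
    (cnj_vec ?c1 - cnj_vec ?z1 + cnj_vec ?z1 v* Ai + (?z2 - cnj_vec ?c2) v* R)
    (?z2 - (?z2 - cnj_vec ?c2) v* T + cnj_vec ?z1 v* P)"
  define b where "b = join_vec (?z1 - Ai *v (?z1 - ?c1) + P *v cnj_vec ?z2)
    (?c2 - cnj_vec ?z2 + T *v cnj_vec ?z2 + R *v (?z1 - ?c1))"
  define c where "c = cnj_vec (s_map z0) \<bullet>\<^sub>C z - of_real ((norm z0)\<^sup>2) / 2 + q (z - s_map z0) (cnj_vec z) - z \<bullet>\<^sub>C cnj_vec z"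
  define e where "e = exp (\<i> * of_real lam * of_real c0) * inverse (det A)"
  define F where "F w = exp (of_real lam / 2 * (- (cnj_vec w \<bullet>\<^sub>C (?M *v w)) + a \<bullet>\<^sub>C w + b \<bullet>\<^sub>C cnj_vec w))" for w
  have exponent: "cnj_vec (s_map z0) \<bullet>\<^sub>C (z + w) - of_real ((norm z0)\<^sup>2) / 2 + q (z + w - s_map z0) (cnj_vec (z - w)) +
      (- (z \<bullet>\<^sub>C cnj_vec z) - w \<bullet>\<^sub>C cnj_vec w + z \<bullet>\<^sub>C cnj_vec w - cnj_vec z \<bullet>\<^sub>C w) =
    c + (- (cnj_vec (s_map w) \<bullet>\<^sub>C (?M *v s_map w)) + a \<bullet>\<^sub>C s_map w + b \<bullet>\<^sub>C cnj_vec (s_map w))" for w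
    unfolding c_def a_def b_def q_def V_def
    by (simp add: dot_block dot_linear matrix_minus matrix_vector_mult_diff_distrib
        matrix_vector_right_distrib matrix_vector_mult_add_rdistrib dot_commute algebra_simps)
  have integrand: "op_kernel lam (pi_rep lam ((z0, cnj_vec z0), c0, k)) (z + w) (z - w) *
      exp (of_real lam / 2 * (- (z \<bullet>\<^sub>C cnj_vec z) - w \<bullet>\<^sub>C cnj_vec w + z \<bullet>\<^sub>C cnj_vec w - cnj_vec z \<bullet>\<^sub>C w)) =
    e * exp (of_real lam / 2 * c) * F (s_map w)" for w
    unfolding op_kernel_pi[OF lam] F_def e_def
    by (simp only: mult.assoc exp_add[symmetric] distrib_left[symmetric] exponent)
  obtain \<epsilon> where \<epsilon>: "\<epsilon> > 0" "\<And>u. \<epsilon> * (norm u)\<^sup>2 \<le> Re (cnj_vec u \<bullet>\<^sub>C (?M *v u))"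
    using coercive_M by blast
  \<comment> \<open>The midpoint relation read in the mixed coordinates of \<open>PG\<close> is
    exactly the system with matrix 1 + V.\<close>
  have "k *v (s_map z - u) = s_map z + u - z0"
    using u by (simp add: matrix_vector_mult_diff_distrib algebra_simps)
  from PG[OF this] have PG: "?z1 - upper_vec u = Ai *v (?z1 + upper_vec u - ?c1) - P *v (cnj_vec ?z2 - lower_vec u)"
    "cnj_vec ?z2 + lower_vec u - ?c2 = R *v (?z1 + upper_vec u - ?c1) + T *v (cnj_vec ?z2 - lower_vec u)"
    by simp_all
  have sol: "?M *v u = b"
  proof (rule vec_upper_lower_eqI)
    show "upper_vec (?M *v u) = upper_vec b"
      using PG(1) by (simp add: b_def V_def matrix_vector_mult_add_rdistrib matrix_vector_mult_diff_distrib
          matrix_vector_right_distrib algebra_simps)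
    show "lower_vec (?M *v u) = lower_vec b"
      using PG(2) by (simp add: b_def V_def matrix_vector_mult_add_rdistrib matrix_vector_mult_diff_distrib
          matrix_vector_right_distrib matrix_minus algebra_simps)
  qed
  have "weyl_symbol lam (pi_rep lam ((z0, cnj_vec z0), c0, k)) z =
      2 ^ CARD('p + 'q) * (e * exp (of_real lam / 2 * c) * (LINT w|dm_lam lam. F (s_map w)))"
    unfolding weyl_symbol_def integrand by (simp only: integral_mult_right_zero)
  also have "(LINT w|dm_lam lam. F (s_map w)) = (LINT w|dm_lam lam. F w)"
  proof (rule integral_s_map[OF _ lam])
    show "continuous_on UNIV F"
      unfolding F_def dot_def cnj_vec_def matrix_vector_mult_def by (auto intro!: continuous_intros)
  qed
  also have "\<dots> = exp (of_real lam / 2 * (a \<bullet>\<^sub>C u)) / det ?M"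
    unfolding F_def by (rule integral_gauss_vec[OF lam \<epsilon> sol])
  also have "e * exp (of_real lam / 2 * c) * (exp (of_real lam / 2 * (a \<bullet>\<^sub>C u)) / det ?M) =
      exp (\<i> * of_real lam * of_real c0) * inverse (det A * det ?M) * exp (of_real lam / 2 * (c + a \<bullet>\<^sub>C u))"
    unfolding e_def distrib_left[of _ c] exp_add divide_inverse inverse_mult_distrib by (simp only: mult_ac)
  also have "c + a \<bullet>\<^sub>C u = herm z0 (s_map z + u) - 2 * herm (s_map z) u - herm z0 z0 / 2"
  proof -
    \<comment> \<open>The terms are grouped so that the right-hand sides of \<open>PG\<close>
      appear; folding them removes every block of \<open>k\<close>, and what remains is a
      combination of values of \<open>herm\<close>.\<close>
    have "c + a \<bullet>\<^sub>C u = cnj_vec ?z1 \<bullet>\<^sub>C (Ai *v (?z1 + upper_vec u - ?c1) - P *v (cnj_vec ?z2 - lower_vec u))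
      + (?z2 - cnj_vec ?c2) \<bullet>\<^sub>C (R *v (?z1 + upper_vec u - ?c1) + T *v (cnj_vec ?z2 - lower_vec u))
      + (cnj_vec ?c1 \<bullet>\<^sub>C (?z1 + upper_vec u) + ?c2 \<bullet>\<^sub>C ?z2 - of_real ((norm z0)\<^sup>2) / 2 - z \<bullet>\<^sub>C cnj_vec z
        - cnj_vec ?z1 \<bullet>\<^sub>C upper_vec u + ?z2 \<bullet>\<^sub>C lower_vec u)"
      unfolding c_def a_def q_def
      by (simp add: dot_block dot_linear matrix_minus matrix_vector_mult_diff_distrib
          matrix_vector_right_distrib dot_commute algebra_simps)
    also have "\<dots> = herm z0 (s_map z + u) - 2 * herm (s_map z) u - herm z0 z0 / 2"
      unfolding PG[symmetric] cnj_vec_dot_self[of z0, symmetric]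
      by (simp add: herm_block dot_block dot_linear dot_commute field_simps)
    finally show ?thesis .
  qed
  finally show ?thesis by (simp only: det_M mult.assoc)
qed

text \<open>All three follow by expanding with the invariance of \<open>herm\<close>. The first says
  that the Cayley transform (k - 1)(k + 1)^-1 is skew for \<open>herm\<close>; the second uses that
  \<zeta> + (k x - x) is 2 k x.\<close>

lemma herm_cayley:
  assumes \<zeta>: "k *v x + x = \<zeta>" and c: "k *v y + y = c"
  shows "herm (k *v x - x) \<zeta> + herm \<zeta> (k *v x - x) = 0"
    "herm c (\<zeta> + (k *v x - x)) = 2 * herm y \<zeta>"
    "herm c c = herm c y + herm y c"
  unfolding \<zeta>[symmetric] c[symmetric] by (simp_all only: herm_linear herm_k) simp_all

lemma weyl_pi_tilde:
  assumes lam: "lam > 0"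
  shows "weyl_symbol lam (pi_rep lam ((z0, cnj_vec z0), c0, k)) z =
    2 ^ CARD('p + 'q) * exp (\<i> * of_real lam * of_real c0) * inverse (det (k + mat 1)) *
     (exp (of_real lam / 2 *
       (real_form z \<bullet>\<^sub>C
         ((Jmat ** matrix_inv (tilde_mat k + mat 1) ** (tilde_mat k - mat 1)) *v real_form z))) *
     exp (of_real lam *
       (real_form z \<bullet>\<^sub>C
         ((Jmat ** matrix_inv (tilde_mat k + mat 1)) *v real_form (s_map z0)))) *
     exp (- of_real lam / 4 *
       (real_form (s_map z0) \<bullet>\<^sub>C
         ((Jmat ** matrix_inv (tilde_mat k + mat 1)) *v real_form (s_map z0)))))"
proof -
  let ?\<zeta> = "s_map z"
  obtain x where x: "k *v x + x = ?\<zeta>" by (rule solve)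
  obtain y where y: "k *v y + y = z0" by (rule solve)
  \<comment> \<open>The critical point is \<open>X + y\<close>: the Cayley transform of s(z) plus
    the solution for \<open>z0\<close>. Quadratic, mixed and constant terms in z then separate into
    the three exponentials.\<close>
  define X where "X = k *v x - x"
  have x': "k *v X + X = k *v ?\<zeta> - ?\<zeta>"
    unfolding x[symmetric] X_def by (simp add: matrix_vector_mult_diff_distrib matrix_vector_right_distrib)
  have u: "k *v (X + y) + (X + y) = k *v ?\<zeta> - ?\<zeta> + z0"
    unfolding x'[symmetric] y[symmetric] by (simp add: matrix_vector_right_distrib)
  have z: "real_form z = real_form (s_map ?\<zeta>)" by simp
  have J: "real_form z \<bullet>\<^sub>C (Jmat *v real_form (s_map v)) = herm v ?\<zeta> - herm ?\<zeta> v" for v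
    using Jmat_real_form[of ?\<zeta> v] by simp
  have Q: "real_form z \<bullet>\<^sub>C ((Jmat ** matrix_inv (tilde_mat k + mat 1) ** (tilde_mat k - mat 1)) *v real_form z)
      = herm X ?\<zeta> - herm ?\<zeta> X"
  proof -
    have "(tilde_mat k - mat 1) *v real_form z = real_form (s_map (k *v ?\<zeta> - ?\<zeta>))"
      unfolding z by (simp add: matrix_vector_mult_diff_rdistrib tilde_real_form real_form_linear s_map_linear del: s_map_s_map)
    then show ?thesis
      by (simp add: matrix_vector_mul_assoc[symmetric] tilde_inv[OF x'] J)
  qed
  have L: "real_form z \<bullet>\<^sub>C ((Jmat ** matrix_inv (tilde_mat k + mat 1)) *v real_form (s_map z0)) = herm y ?\<zeta> - herm ?\<zeta> y"
    by (simp add: matrix_vector_mul_assoc[symmetric] tilde_inv[OF y] J)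
  have K: "real_form (s_map z0) \<bullet>\<^sub>C ((Jmat ** matrix_inv (tilde_mat k + mat 1)) *v real_form (s_map z0)) = herm y z0 - herm z0 y"
    by (simp add: matrix_vector_mul_assoc[symmetric] tilde_inv[OF y] Jmat_real_form)
  note h = herm_cayley[OF x y, folded X_def]
  have "herm X ?\<zeta> = - herm ?\<zeta> X" using h(1) by (simp add: eq_neg_iff_add_eq_0)
  moreover have "herm z0 (?\<zeta> + (X + y)) = herm z0 (?\<zeta> + X) + herm z0 y"
    by (simp add: herm_linear)
  moreover have "herm ?\<zeta> (X + y) = herm ?\<zeta> X + herm ?\<zeta> y"
    by (simp add: herm_linear)
  ultimately have "of_real lam / 2 * (herm z0 (?\<zeta> + (X + y)) - 2 * herm ?\<zeta> (X + y) - herm z0 z0 / 2) =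
      of_real lam / 2 * (herm X ?\<zeta> - herm ?\<zeta> X) + of_real lam * (herm y ?\<zeta> - herm ?\<zeta> y)
      + - of_real lam / 4 * (herm y z0 - herm z0 y)"
    unfolding h(2,3) by (simp add: field_simps)
  then show ?thesis
    unfolding weyl_pi[OF lam u] Q L K by (simp only: exp_add)
qed

end

text \<open>The real number det (k + 1) can have either sign: in SU(1,1) it equals 2 + tr k, which
  is negative when tr k < -2. Its inverse is therefore split into sign and inverse modulus; the
  formula with the modulus alone is the case of a positive determinant.\<close>

theorem theorem5p3:
  fixes lam c0 :: real
    and z0 z :: "complex ^ ('p::finite + 'q::finite)"
    and k :: "complex ^ ('p + 'q) ^ ('p + 'q)"
    and g :: "((complex ^ ('p + 'q)) \<times> (complex ^ ('p + 'q))) \<times> real \<times>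
                (complex ^ ('p + 'q) ^ ('p + 'q))"
  assumes "lam > 0"
    and "g = ((z0, cnj_vec z0), c0, k)"
    and "g \<in> carrier G_group"
    and "invertible (k + mat 1)"
  shows "weyl_symbol lam (pi_rep lam g) z =
    of_real (sgn (Re (det (k + mat 1)))) *
    (2 ^ CARD('p + 'q) * exp (\<i> * of_real lam * of_real c0) *
     inverse (of_real (cmod (det (k + mat 1)))) *
     exp (of_real lam / 2 *
       (join_vec z (cnj_vec z) \<bullet>\<^sub>C
         ((Jmat ** matrix_inv (tilde_mat k + mat 1) ** (tilde_mat k - mat 1)) *v
           join_vec z (cnj_vec z)))) *
     exp (of_real lam *
       (join_vec z (cnj_vec z) \<bullet>\<^sub>C
         ((Jmat ** matrix_inv (tilde_mat k + mat 1)) *v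
           join_vec (s_map z0) (cnj_vec (s_map z0))))) *
     exp (- of_real lam / 4 *
       (join_vec (s_map z0) (cnj_vec (s_map z0)) \<bullet>\<^sub>C
         ((Jmat ** matrix_inv (tilde_mat k + mat 1)) *v
           join_vec (s_map z0) (cnj_vec (s_map z0))))))"
proof -
  have "k \<in> SU_pq" using assms(2,3) by (simp add: G_group_def)
  then interpret SU_pq_regular k by unfold_locales (use assms(4) in auto)
  let ?d = "det (k + mat 1)"
  have d: "?d = of_real (Re ?d)" using det_k_real by (simp add: complex_eq_iff)
  have "?d \<noteq> 0" using assms(4) by (simp add: invertible_det_nz)
  with d have "Re ?d \<noteq> 0" by auto
  then have "inverse (Re ?d) = sgn (Re ?d) * inverse \<bar>Re ?d\<bar>"
    by (simp add: sgn_if)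
  then have "inverse (of_real (Re ?d) :: complex) =
      of_real (sgn (Re ?d)) * inverse (of_real \<bar>Re ?d\<bar>)"
    by (metis of_real_inverse of_real_mult)
  with d have "inverse ?d = of_real (sgn (Re ?d)) * inverse (of_real (cmod ?d))"
    by (metis norm_of_real)
  then show ?thesis
    unfolding assms(2) weyl_pi_tilde[OF assms(1)] real_form_def by (simp only: mult_ac)
qed

end
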